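(* Let $q$ be a power of a prime $p$, let $\mathbb{F}_q$ be the finite field with $q$ elements, let $V$ be an $\mathbb{F}_q$-vector space of finite dimension $d$, and let $G \subseteq GL(V)$ be a subgroup. Let $R = \mathbb{F}_q[V] = \operatorname{Sym}(V^* )$ and $S = R^G$, and let $\mathcal{P}^a$ ($a \geq 0$) denote the Steenrod operators on $R$ and on $S$. Fix $i \geq 0$. Then there exist $\mathbb{F}_q$-linear maps $\mathcal{Q}^m \colon H^i(G,R) \to H^i(G,R)$ for $m \geq 0$, with $\mathcal{Q}^0$ the identity, such that for all $m \geq 0$, $s \in S$ and $\alpha \in H^i(G,R)$, $$\mathcal{Q}^m(s\alpha) = \sum_{a+b=m} \mathcal{P}^a(s)\,\mathcal{Q}^b(\alpha).$$
   Context: The group $G$ (which is finite) acts on $V^*$ by the dual action and on $R = \operatorname{Sym}(V^* )$ by the induced $\mathbb{F}_q$-algebra automorphisms. $R$ is a module over the group ring $S[G]$, and $H^i(G,-)$ denotes the $i$-th right derived functor of the fixed-point functor $M \mapsto M^G$ from $S[G]$-modules to $S$-modules (equivalently $H^i(G,M) = \operatorname{Ext}^i_{S[G]}(S,M)$), so $H^i(G,R)$ is an $S$-module. Steenrod operators: let $P(\xi)\colon \mathbb{F}_q[V] \to \mathbb{F}_q[V][\xi]$ be the $\mathbb{F}_q$-algebra homomorphism determined by $P(\xi)(v) = v + v^q\xi$ for all $v \in V^*$. The $\mathbb{F}_q$-linear maps $\mathcal{P}^i \colon \mathbb{F}_q[V] \to \mathbb{F}_q[V]$, $i \geq 0$,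 are defined by $P(\xi)(f) = \sum_{i \geq 0} \mathcal{P}^i(f)\xi^i$. $\mathcal{P}^0$ is the identity. (For $p=2$ these are also written $\mathcal{S}_q^i$.) The maps $\mathcal{P}^i$ commute with the action of $G$, so they restrict to maps $\mathcal{P}^i \colon S \to S$. *)

theory Defs
  imports "HOL-Algebra.Algebra" "HOL-Algebra.Algebraic_Closure_Type" "HOL-Library.Poly_Mapping"
begin

section \<open>The symmetric algebra of the dual space\<close>

text \<open>The vector space is the whole type \<open>'v\<close> with scalar multiplication \<open>scale\<close>
  over the field \<open>'k\<close>.\<close>

type_synonym ('k, 'v) dual_poly = "(('v \<Rightarrow> 'k) \<Rightarrow>\<^sub>0 nat) \<Rightarrow>\<^sub>0 'k"

type_synonym ('k, 'v) sym = "('k, 'v) dual_poly set"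

definition dual :: "('k::field \<Rightarrow> 'v::ab_group_add \<Rightarrow> 'v) \<Rightarrow> ('v \<Rightarrow> 'k) set" where
  "dual scale = {\<phi>. Vector_Spaces.linear scale (*) \<phi>}"

definition GL :: "('k::field \<Rightarrow> 'v::ab_group_add \<Rightarrow> 'v) \<Rightarrow> ('v \<Rightarrow> 'v) monoid" where
  "GL scale = \<lparr>carrier = {g. Vector_Spaces.linear scale scale g \<and> bij g}, monoid.mult = (\<circ>), one = id\<rparr>"

definition pvar :: "('v \<Rightarrow> 'k) \<Rightarrow> ('k::field, 'v) dual_poly" where
  "pvar \<phi> = Poly_Mapping.single (Poly_Mapping.single \<phi> 1) 1"

definition pconst :: "'k \<Rightarrow> ('k::field, 'v) dual_poly" where
  "pconst a = Poly_Mapping.single 0 a"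

text \<open>\<open>Sym(V\<^sup>*)\<close> is the polynomial ring with one variable for each element of \<open>V\<^sup>*\<close>, modulo
  the relations that make the map from \<open>V\<^sup>*\<close> linear.\<close>

definition free_alg :: "('k::field \<Rightarrow> 'v::ab_group_add \<Rightarrow> 'v) \<Rightarrow> ('k, 'v) dual_poly ring" where
  "free_alg scale = ring_of_type_algebra
     \<lparr>carrier := {p. \<forall>m \<in> Poly_Mapping.keys p. Poly_Mapping.keys m \<subseteq> dual scale}\<rparr>"

definition sym_ideal :: "('k::field \<Rightarrow> 'v::ab_group_add \<Rightarrow> 'v) \<Rightarrow> ('k, 'v) dual_poly set" where
  "sym_ideal scale = genideal (free_alg scale)
     ({pvar (\<lambda>v. \<phi> v + \<psi> v) - pvar \<phi> - pvar \<psi> | \<phi> \<psi>. \<phi> \<in> dual scale \<and> \<psi> \<in> dual scale} \<union>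
      {pvar (\<lambda>v. a * \<phi> v) - pconst a * pvar \<phi> | a \<phi>. \<phi> \<in> dual scale})"

definition Sym :: "('k::field \<Rightarrow> 'v::ab_group_add \<Rightarrow> 'v) \<Rightarrow> ('k, 'v) sym ring" where
  "Sym scale = free_alg scale Quot sym_ideal scale"

definition sym_of_dual ::
    "('k::field \<Rightarrow> 'v::ab_group_add \<Rightarrow> 'v) \<Rightarrow> ('v \<Rightarrow> 'k) \<Rightarrow> ('k, 'v) sym" where
  "sym_of_dual scale \<phi> = sym_ideal scale +>\<^bsub>free_alg scale\<^esub> pvar \<phi>"

definition sym_const :: "('k::field \<Rightarrow> 'v::ab_group_add \<Rightarrow> 'v) \<Rightarrow> 'k \<Rightarrow> ('k, 'v) sym" where
  "sym_const scale a = sym_ideal scale +>\<^bsub>free_alg scale\<^esub> pconst a"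

definition ground_field :: "('k::field \<Rightarrow> 'v::ab_group_add \<Rightarrow> 'v) \<Rightarrow> ('k, 'v) sym ring" where
  "ground_field scale = (Sym scale)\<lparr>carrier := range (sym_const scale)\<rparr>"

text \<open>The algebra homomorphism from \<open>Sym(V\<^sup>*)\<close> to \<open>T\<close> determined by its values \<open>h\<close> on \<open>V\<^sup>*\<close>,
  where \<open>c\<close> is the structure map of the algebra \<open>T\<close>. Extensionality only fixes the junk
  values outside the carrier, so that the homomorphism is unique as a HOL function.\<close>

definition sym_hom ::
    "('k::field \<Rightarrow> 'v::ab_group_add \<Rightarrow> 'v) \<Rightarrow> ('t, 'x) ring_scheme \<Rightarrow> ('k \<Rightarrow> 't) \<Rightarrow>
     (('v \<Rightarrow> 'k) \<Rightarrow> 't) \<Rightarrow> ('k, 'v) sym \<Rightarrow> 't" where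
  "sym_hom scale T c h =
     (THE f. f \<in> extensional (carrier (Sym scale)) \<and> f \<in> ring_hom (Sym scale) T \<and>
       (\<forall>a. f (sym_const scale a) = c a) \<and>
       (\<forall>\<phi> \<in> dual scale. f (sym_of_dual scale \<phi>) = h \<phi>))"

definition sym_action ::
    "('k::field \<Rightarrow> 'v::ab_group_add \<Rightarrow> 'v) \<Rightarrow> ('v \<Rightarrow> 'v) \<Rightarrow> ('k, 'v) sym \<Rightarrow> ('k, 'v) sym" where
  "sym_action scale g =
     sym_hom scale (Sym scale) (sym_const scale)
       (\<lambda>\<phi>. sym_of_dual scale (\<phi> \<circ> inv\<^bsub>GL scale\<^esub> g))"

definition invariant_ring ::
    "('k::field \<Rightarrow> 'v::ab_group_add \<Rightarrow> 'v) \<Rightarrow> ('v \<Rightarrow> 'v) set \<Rightarrow> ('k, 'v) sym ring" where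
  "invariant_ring scale G =
     (Sym scale)\<lparr>carrier := {f \<in> carrier (Sym scale). \<forall>g \<in> G. sym_action scale g f = f}\<rparr>"

section \<open>Steenrod operators\<close>

definition steenrod_total ::
    "('k::field \<Rightarrow> 'v::ab_group_add \<Rightarrow> 'v) \<Rightarrow> nat \<Rightarrow> ('k, 'v) sym \<Rightarrow> nat \<Rightarrow> ('k, 'v) sym" where
  "steenrod_total scale q =
     (let R = Sym scale; RX = UP R in
      sym_hom scale RX (\<lambda>a. up_ring.monom RX (sym_const scale a) 0)
        (\<lambda>\<phi>. up_ring.monom RX (sym_of_dual scale \<phi>) 0 \<oplus>\<^bsub>RX\<^esub>
              up_ring.monom RX (sym_of_dual scale \<phi> [^]\<^bsub>R\<^esub> q) 1))"

definition steenrod ::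
    "('k::field \<Rightarrow> 'v::ab_group_add \<Rightarrow> 'v) \<Rightarrow> nat \<Rightarrow> nat \<Rightarrow> ('k, 'v) sym \<Rightarrow> ('k, 'v) sym" where
  "steenrod scale q i f = up_ring.coeff (UP (Sym scale)) (steenrod_total scale q f) i"

section \<open>Group cohomology as a right derived functor\<close>

definition mod_hom ::
    "('s, 'x) ring_scheme \<Rightarrow> ('s, 'a, 'y) module_scheme \<Rightarrow> ('s, 'b, 'z) module_scheme \<Rightarrow>
     ('a \<Rightarrow> 'b) set" where
  "mod_hom S M N =
     {f \<in> carrier M \<rightarrow> carrier N.
        (\<forall>x \<in> carrier M. \<forall>y \<in> carrier M. f (x \<oplus>\<^bsub>M\<^esub> y) = f x \<oplus>\<^bsub>N\<^esub> f y) \<and>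
        (\<forall>s \<in> carrier S. \<forall>x \<in> carrier M. f (s \<odot>\<^bsub>M\<^esub> x) = s \<odot>\<^bsub>N\<^esub> f x)}"

text \<open>A module over the group ring \<open>S[G]\<close> is given as an \<open>S\<close>-module with an action of \<open>G\<close> by
  \<open>S\<close>-linear maps.\<close>

definition group_ring_module ::
    "('s, 'x) ring_scheme \<Rightarrow> ('g, 'y) monoid_scheme \<Rightarrow> ('s, 'm) module \<Rightarrow>
     ('g \<Rightarrow> 'm \<Rightarrow> 'm) \<Rightarrow> bool" where
  "group_ring_module S G M \<rho> \<longleftrightarrow>
     module S M \<and> group_action G (carrier M) \<rho> \<and> (\<forall>g \<in> carrier G. \<rho> g \<in> mod_hom S M M)"

definition group_ring_hom ::
    "('s, 'x) ring_scheme \<Rightarrow> ('g, 'y) monoid_scheme \<Rightarrow> ('s, 'a) module \<Rightarrow> ('g \<Rightarrow> 'a \<Rightarrow> 'a) \<Rightarrow>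
     ('s, 'b) module \<Rightarrow> ('g \<Rightarrow> 'b \<Rightarrow> 'b) \<Rightarrow> ('a \<Rightarrow> 'b) set" where
  "group_ring_hom S G M \<rho> N \<sigma> =
     {f \<in> mod_hom S M N. \<forall>g \<in> carrier G. \<forall>x \<in> carrier M. f (\<rho> g x) = \<sigma> g (f x)}"

text \<open>HOL cannot quantify over modules of all types inside a definition, so the test modules
  \<open>A\<close> and \<open>B\<close> are those carried by the type \<open>'g \<Rightarrow> 's + 'm\<close>. This is no restriction: \<open>S[G]\<close>
  consists of functions from \<open>G\<close> to \<open>S\<close> when \<open>G\<close> is finite, so the type contains copies of
  \<open>S[G]\<close> and its left ideals, and these suffice by Baer's criterion.\<close>

definition injective_module ::
    "('s, 'x) ring_scheme \<Rightarrow> ('g, 'y) monoid_scheme \<Rightarrow> ('s, 'm) module \<Rightarrow>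
     ('g \<Rightarrow> 'm \<Rightarrow> 'm) \<Rightarrow> bool" where
  "injective_module S G E \<sigma> \<longleftrightarrow>
     group_ring_module S G E \<sigma> \<and>
     (\<forall>(A :: ('s, 'g \<Rightarrow> 's + 'm) module) \<alpha> (B :: ('s, 'g \<Rightarrow> 's + 'm) module) \<beta> j f.
        group_ring_module S G A \<alpha> \<and> group_ring_module S G B \<beta> \<and>
        j \<in> group_ring_hom S G A \<alpha> B \<beta> \<and> inj_on j (carrier A) \<and>
        f \<in> group_ring_hom S G A \<alpha> E \<sigma> \<longrightarrow>
        (\<exists>h \<in> group_ring_hom S G B \<beta> E \<sigma>. \<forall>a \<in> carrier A. h (j a) = f a))"

text \<open>\<open>0 \<rightarrow> M \<rightarrow> E 0 \<rightarrow> E 1 \<rightarrow> \<dots>\<close> with augmentation \<open>\<epsilon>\<close> and differentials \<open>\<delta> n : E n \<rightarrow> E (n + 1)\<close>.\<close>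

definition injective_resolution ::
    "('s, 'x) ring_scheme \<Rightarrow> ('g, 'y) monoid_scheme \<Rightarrow> ('s, 'a) module \<Rightarrow> ('g \<Rightarrow> 'a \<Rightarrow> 'a) \<Rightarrow>
     (nat \<Rightarrow> ('s, 'm) module) \<Rightarrow> (nat \<Rightarrow> 'g \<Rightarrow> 'm \<Rightarrow> 'm) \<Rightarrow> ('a \<Rightarrow> 'm) \<Rightarrow>
     (nat \<Rightarrow> 'm \<Rightarrow> 'm) \<Rightarrow> bool" where
  "injective_resolution S G M \<rho> E \<sigma> \<epsilon> \<delta> \<longleftrightarrow>
     (\<forall>n. injective_module S G (E n) (\<sigma> n)) \<and>
     \<epsilon> \<in> group_ring_hom S G M \<rho> (E 0) (\<sigma> 0) \<and>
     (\<forall>n. \<delta> n \<in> group_ring_hom S G (E n) (\<sigma> n) (E (Suc n)) (\<sigma> (Suc n))) \<and>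
     inj_on \<epsilon> (carrier M) \<and>
     \<epsilon> ` carrier M = a_kernel (E 0) (E (Suc 0)) (\<delta> 0) \<and>
     (\<forall>n. \<delta> n ` carrier (E n) = a_kernel (E (Suc n)) (E (Suc (Suc n))) (\<delta> (Suc n)))"

definition fixed_points ::
    "('g, 'y) monoid_scheme \<Rightarrow> ('s, 'm) module \<Rightarrow> ('g \<Rightarrow> 'm \<Rightarrow> 'm) \<Rightarrow> ('s, 'm) module" where
  "fixed_points G M \<rho> = M\<lparr>carrier := {x \<in> carrier M. \<forall>g \<in> carrier G. \<rho> g x = x}\<rparr>"

text \<open>The fields \<open>mult\<close> and \<open>one\<close> of a module record carry no information.\<close>

definition quotient_module :: "('s, 'm) module \<Rightarrow> 'm set \<Rightarrow> ('s, 'm set) module" where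
  "quotient_module M B =
     \<lparr>carrier = a_rcosets\<^bsub>M\<^esub> B, monoid.mult = undefined, one = undefined,
      ring.zero = B, add = set_add M,
      module.smult = (\<lambda>s Y. \<Union>y \<in> Y. B +>\<^bsub>M\<^esub> (s \<odot>\<^bsub>M\<^esub> y))\<rparr>"

definition cohomology ::
    "(nat \<Rightarrow> ('s, 'm) module) \<Rightarrow> (nat \<Rightarrow> 'm \<Rightarrow> 'm) \<Rightarrow> nat \<Rightarrow> ('s, 'm set) module" where
  "cohomology C \<delta> i =
     quotient_module ((C i)\<lparr>carrier := a_kernel (C i) (C (Suc i)) (\<delta> i)\<rparr>)
       (case i of 0 \<Rightarrow> {\<zero>\<^bsub>C 0\<^esub>} | Suc n \<Rightarrow> \<delta> n ` carrier (C n))"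

text \<open>\<open>H\<^sup>i(G, M)\<close>, computed from an injective resolution \<open>(E, \<sigma>, \<delta>)\<close> of \<open>M\<close>.\<close>

definition group_cohomology ::
    "('g, 'y) monoid_scheme \<Rightarrow> (nat \<Rightarrow> ('s, 'm) module) \<Rightarrow> (nat \<Rightarrow> 'g \<Rightarrow> 'm \<Rightarrow> 'm) \<Rightarrow>
     (nat \<Rightarrow> 'm \<Rightarrow> 'm) \<Rightarrow> nat \<Rightarrow> ('s, 'm set) module" where
  "group_cohomology G E \<sigma> \<delta> i = cohomology (\<lambda>n. fixed_points G (E n) (\<sigma> n)) \<delta> i"

definition regular_module :: "('s, 'x) ring_scheme \<Rightarrow> ('s, 's) module" where
  "regular_module R =
     \<lparr>carrier = carrier R, monoid.mult = monoid.mult R, one = one R, ring.zero = ring.zero R, add = add R,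
      module.smult = monoid.mult R\<rparr>"

end

theory Submission
  imports Defs
begin

text \<open>The operations exist already on the cochains. Let \<open>P\<close> denote the Steenrod operators, let
  \<open>R \<rightarrow> E\<^sub>0 \<rightarrow> E\<^sub>1 \<rightarrow> \<dots>\<close> be the injective resolution of \<open>R = Sym(V\<^sup>*)\<close>, and call a
  family \<open>q\<^sup>m\<close> of additive \<open>G\<close>-equivariant maps on an \<open>S[G]\<close>-module a Cartan family if
  \<open>q\<^sup>m(s x) = \<Sum>\<^sub>a P\<^sup>a(s) q\<^sup>m\<^sup>-\<^sup>a(x)\<close> for all \<open>s \<in> S\<close>. The Steenrod operators are such a family on
  \<open>R\<close>. It is enough to lift it to Cartan families on all \<open>E\<^sub>n\<close> that begin with the identity and
  commute with the differentials: such families preserve fixed points, cocycles and coboundaries,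
  so they descend to \<open>H\<^sup>i(G, R) = H\<^sup>i(E\<^sup>G)\<close> and keep the Cartan formula there.

  The lift is constructed degree by degree. On the image of \<open>E\<^sub>n\<close> in \<open>E\<^sub>n\<^sub>+\<^sub>1\<close> a Cartan family is forced,
  and what is left is to extend a Cartan family from a submodule \<open>A\<close> of an injective module \<open>E\<close>
  to all of \<open>E\<close>. The maps \<open>q\<^sup>m\<close> are not \<open>S\<close>-linear, so injectivity does not apply to them
  directly. Suppose that \<open>q\<^sup>0, \<dots>, q\<^sup>n\<close> are given on \<open>E\<close>, and put
  \<open>c\<^sub>s(x) = \<Sum>\<^sub>a P\<^sup>a\<^sup>+\<^sup>1(s) q\<^sup>n\<^sup>-\<^sup>a(x)\<close>. The Cartan formula in degree \<open>n + 1\<close> says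
  \<open>q\<^sup>n\<^sup>+\<^sup>1(s x) = s q\<^sup>n\<^sup>+\<^sup>1(x) + c\<^sub>s(x)\<close>, and the formulas in lower degrees make \<open>c\<close> a cocycle:
  \<open>c\<^sub>s\<^sub>t(x) = s c\<^sub>t(x) + c\<^sub>s(t x)\<close>. Hence \<open>E \<times> A\<close> becomes an \<open>S[G]\<close>-module with the twisted
  multiplication \<open>s (e, x) = (s e + c\<^sub>s(x), s x)\<close>, and \<open>q\<^sup>n\<^sup>+\<^sup>1\<close> satisfies the formula on \<open>A\<close> precisely
  when \<open>(e, x) \<mapsto> e - q\<^sup>n\<^sup>+\<^sup>1(x)\<close> is linear on this module. Injectivity of \<open>E\<close> extends this linear
  map from \<open>E \<times> A\<close> to \<open>E \<times> E\<close>, and restricting the extension to \<open>0 \<times> E\<close> gives the new operator up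
  to sign. This is \<open>cartan_extension_step\<close>; \<open>cartan_resolution\<close> and \<open>cartan_cohomology\<close> draw the
  consequences.

  The facts about Steenrod operators that enter are that the total operator is a ring homomorphism,
  that it starts with the identity, that its higher terms vanish on scalars, and that it commutes
  with \<open>G\<close>. The first is the universal property \<open>sym_hom_universal\<close> of \<open>Sym(V\<^sup>*)\<close>, and the others
  are checked on generators, by the induction rule \<open>Sym_induct\<close>.\<close>

section \<open>Finite sums in abelian monoids\<close>

text \<open>Both sides sum \<open>f i j\<close> over the triangle \<open>i + j \<le> m\<close>, once along its diagonals and once along
  its rows. This reindexing is what turns the product of two Cartan formulas into one.\<close>

lemma (in abelian_monoid) finsum_triangle:
  fixes m :: nat
  assumes "\<And>i j. i + j \<le> m \<Longrightarrow> f i j \<in> carrier G"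
  shows "(\<Oplus>a\<in>{..m}. \<Oplus>i\<in>{..a}. f i (a - i)) = (\<Oplus>i\<in>{..m}. \<Oplus>j\<in>{..m - i}. f i j)"
  using assms
proof (induction m)
  case 0
  then show ?case by simp
next
  case (Suc m)
  have IH: "(\<Oplus>a\<in>{..m}. \<Oplus>i\<in>{..a}. f i (a - i)) = (\<Oplus>i\<in>{..m}. \<Oplus>j\<in>{..m - i}. f i j)"
    by (rule Suc.IH) (simp add: Suc.prems)
  have row: "(\<Oplus>j\<in>{..Suc m - i}. f i j) = f i (Suc m - i) \<oplus> (\<Oplus>j\<in>{..m - i}. f i j)" if "i \<le> m" for i
    using that by (simp add: Suc_diff_le Suc.prems Pi_def)
  have "(\<Oplus>i\<in>{..Suc m}. \<Oplus>j\<in>{..Suc m - i}. f i j)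
      = f (Suc m) 0 \<oplus> (\<Oplus>i\<in>{..m}. \<Oplus>j\<in>{..Suc m - i}. f i j)"
    by (subst finsum_Suc) (auto simp: Suc.prems Pi_def intro!: finsum_closed)
  also have "(\<Oplus>i\<in>{..m}. \<Oplus>j\<in>{..Suc m - i}. f i j)
      = (\<Oplus>i\<in>{..m}. f i (Suc m - i) \<oplus> (\<Oplus>j\<in>{..m - i}. f i j))"
    by (rule finsum_cong') (use row in \<open>auto simp: Suc.prems Pi_def\<close>)
  also have "\<dots> = (\<Oplus>i\<in>{..m}. f i (Suc m - i)) \<oplus> (\<Oplus>i\<in>{..m}. \<Oplus>j\<in>{..m - i}. f i j)"
    by (rule finsum_addf) (auto simp: Suc.prems Pi_def intro!: finsum_closed)
  also have "f (Suc m) 0 \<oplus> ((\<Oplus>i\<in>{..m}. f i (Suc m - i)) \<oplus> (\<Oplus>i\<in>{..m}. \<Oplus>j\<in>{..m - i}. f i j))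
     = (\<Oplus>i\<in>{..Suc m}. f i (Suc m - i)) \<oplus> (\<Oplus>i\<in>{..m}. \<Oplus>j\<in>{..m - i}. f i j)"
    by (subst finsum_Suc[of "\<lambda>i. f i (Suc m - i)"])
       (auto simp: Suc.prems Pi_def intro!: a_assoc[symmetric] finsum_closed)
  also have "\<dots> = (\<Oplus>a\<in>{..Suc m}. \<Oplus>i\<in>{..a}. f i (a - i))"
    by (subst finsum_Suc[of "\<lambda>a. \<Oplus>i\<in>{..a}. f i (a - i)"])
       (auto simp: Suc.prems Pi_def IH intro!: finsum_closed)
  finally show ?case ..
qed

text \<open>Submodules and invariant subrings are records that differ from the ambient structure in the
  carrier alone, but the carrier enters the definition of finite sums.\<close>

lemma finsum_restrict_carrier:
  assumes "abelian_monoid M" "abelian_monoid (M\<lparr>carrier := H\<rparr>)" "H \<subseteq> carrier M" "f \<in> A \<rightarrow> H"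
  shows "finsum (M\<lparr>carrier := H\<rparr>) f A = finsum M f A"
proof -
  interpret M: abelian_monoid M by fact
  interpret H: abelian_monoid "M\<lparr>carrier := H\<rparr>" by fact
  show ?thesis using assms(4)
  proof (induction A rule: infinite_finite_induct)
    case (insert x A)
    have "f \<in> A \<rightarrow> carrier M" "f x \<in> carrier M" using insert assms(3) by auto
    moreover have "f \<in> A \<rightarrow> H" "f x \<in> H" using insert by auto
    ultimately show ?case
      using insert H.finsum_insert[of A x f] M.finsum_insert[of A x f] by simp
  qed (simp_all)
qed

lemma additive_zero:
  assumes "abelian_group M" "abelian_group N" "h \<in> carrier M \<rightarrow> carrier N"
    and "\<And>x y. x \<in> carrier M \<Longrightarrow> y \<in> carrier M \<Longrightarrow> h (x \<oplus>\<^bsub>M\<^esub> y) = h x \<oplus>\<^bsub>N\<^esub> h y"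
  shows "h \<zero>\<^bsub>M\<^esub> = \<zero>\<^bsub>N\<^esub>"
proof -
  interpret abelian_group_hom M N h
    by (intro abelian_group_homI assms group_hom.intro group_hom_axioms.intro
        abelian_group.a_group) (use assms in \<open>auto simp: hom_def\<close>)
  show ?thesis by simp
qed

lemma additive_finsum:
  assumes "abelian_group M" "abelian_group N" "h \<in> carrier M \<rightarrow> carrier N"
    and "\<And>x y. x \<in> carrier M \<Longrightarrow> y \<in> carrier M \<Longrightarrow> h (x \<oplus>\<^bsub>M\<^esub> y) = h x \<oplus>\<^bsub>N\<^esub> h y"
    and "f \<in> A \<rightarrow> carrier M"
  shows "h (finsum M f A) = finsum N (\<lambda>x. h (f x)) A"
proof -
  interpret M: abelian_group M by fact
  interpret N: abelian_group N by fact
  show ?thesis using assms(5)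
  proof (induction A rule: infinite_finite_induct)
    case (insert x A)
    have "f \<in> A \<rightarrow> carrier M" "f x \<in> carrier M" "finsum M f A \<in> carrier M" using insert by auto
    moreover have "(\<lambda>x. h (f x)) \<in> A \<rightarrow> carrier N" "h (f x) \<in> carrier N"
      using insert assms(3) by auto
    ultimately show ?case using insert assms(4) by simp
  qed (use additive_zero[OF assms(1-4)] in simp_all)
qed

section \<open>Modules over a group ring\<close>

text \<open>Group actions are valued in extensional bijections; the restriction makes a given action
  extensional, and bijectivity follows from the action of the inverse element.\<close>

lemma group_ring_moduleI:
  assumes "module S M" "group G"
    and "\<And>g. g \<in> carrier G \<Longrightarrow> \<tau> g \<in> mod_hom S M M"
    and "\<And>x. x \<in> carrier M \<Longrightarrow> \<tau> \<one>\<^bsub>G\<^esub> x = x"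
    and "\<And>g h x. g \<in> carrier G \<Longrightarrow> h \<in> carrier G \<Longrightarrow> x \<in> carrier M \<Longrightarrow> \<tau> (g \<otimes>\<^bsub>G\<^esub> h) x = \<tau> g (\<tau> h x)"
  shows "group_ring_module S G M (\<lambda>g. restrict (\<tau> g) (carrier M))"
proof -
  interpret M: module S M by fact
  interpret G: group G by fact
  have closed: "\<tau> g x \<in> carrier M" if "g \<in> carrier G" "x \<in> carrier M" for g x
    using assms(3)[OF that(1)] that(2) by (auto simp: mod_hom_def)
  have inv1: "\<tau> (inv\<^bsub>G\<^esub> g) (\<tau> g x) = x" "\<tau> g (\<tau> (inv\<^bsub>G\<^esub> g) x) = x"
    if "g \<in> carrier G" "x \<in> carrier M" for g x
    using that assms(4) assms(5)[of "inv\<^bsub>G\<^esub> g" g x] assms(5)[of g "inv\<^bsub>G\<^esub> g" x] by simp_all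
  have "bij_betw (\<tau> g) (carrier M) (carrier M)" if "g \<in> carrier G" for g
    by (rule bij_betw_byWitness[where f' = "\<tau> (inv\<^bsub>G\<^esub> g)"]) (use that closed inv1 in auto)
  then have Bij: "restrict (\<tau> g) (carrier M) \<in> Bij (carrier M)" if "g \<in> carrier G" for g
    using that by (auto simp: Bij_def)
  have "group_action G (carrier M) (\<lambda>g. restrict (\<tau> g) (carrier M))"
  proof (intro group_action.intro group_hom.intro group_hom_axioms.intro homI assms group_BijGroup)
    fix g h assume gh: "g \<in> carrier G" "h \<in> carrier G"
    show "restrict (\<tau> g) (carrier M) \<in> carrier (BijGroup (carrier M))"
      using Bij gh by (simp add: BijGroup_def)
    show "restrict (\<tau> (g \<otimes>\<^bsub>G\<^esub> h)) (carrier M)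
        = restrict (\<tau> g) (carrier M) \<otimes>\<^bsub>BijGroup (carrier M)\<^esub> restrict (\<tau> h) (carrier M)"
      using gh Bij by (auto simp: BijGroup_def compose_def assms(5) closed)
  qed
  moreover have "restrict (\<tau> g) (carrier M) \<in> mod_hom S M M" if "g \<in> carrier G" for g
    using assms(3)[OF that] by (auto simp: mod_hom_def)
  ultimately show ?thesis using assms(1) by (auto simp: group_ring_module_def)
qed

lemma group_ring_moduleD:
  assumes "group_ring_module S G M \<sigma>"
  shows "module S M" "group G"
    and "g \<in> carrier G \<Longrightarrow> x \<in> carrier M \<Longrightarrow> \<sigma> g x \<in> carrier M"
    and "g \<in> carrier G \<Longrightarrow> x \<in> carrier M \<Longrightarrow> y \<in> carrier M \<Longrightarrow> \<sigma> g (x \<oplus>\<^bsub>M\<^esub> y) = \<sigma> g x \<oplus>\<^bsub>M\<^esub> \<sigma> g y"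
    and "g \<in> carrier G \<Longrightarrow> s \<in> carrier S \<Longrightarrow> x \<in> carrier M \<Longrightarrow> \<sigma> g (s \<odot>\<^bsub>M\<^esub> x) = s \<odot>\<^bsub>M\<^esub> \<sigma> g x"
    and "x \<in> carrier M \<Longrightarrow> \<sigma> \<one>\<^bsub>G\<^esub> x = x"
    and "g \<in> carrier G \<Longrightarrow> h \<in> carrier G \<Longrightarrow> x \<in> carrier M \<Longrightarrow> \<sigma> (g \<otimes>\<^bsub>G\<^esub> h) x = \<sigma> g (\<sigma> h x)"
proof -
  interpret group_action G "carrier M" \<sigma>
    using assms by (simp add: group_ring_module_def)
  show "module S M" using assms by (simp add: group_ring_module_def)
  show "group G" using group_hom group_hom.axioms(1) by blast
  have hom: "g \<in> carrier G \<Longrightarrow> \<sigma> g \<in> mod_hom S M M" for g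
    using assms by (simp add: group_ring_module_def)
  show "g \<in> carrier G \<Longrightarrow> x \<in> carrier M \<Longrightarrow> \<sigma> g x \<in> carrier M"
    "g \<in> carrier G \<Longrightarrow> x \<in> carrier M \<Longrightarrow> y \<in> carrier M \<Longrightarrow> \<sigma> g (x \<oplus>\<^bsub>M\<^esub> y) = \<sigma> g x \<oplus>\<^bsub>M\<^esub> \<sigma> g y"
    "g \<in> carrier G \<Longrightarrow> s \<in> carrier S \<Longrightarrow> x \<in> carrier M \<Longrightarrow> \<sigma> g (s \<odot>\<^bsub>M\<^esub> x) = s \<odot>\<^bsub>M\<^esub> \<sigma> g x"
    using hom unfolding mod_hom_def by (blast dest: funcset_mem)+
  show "x \<in> carrier M \<Longrightarrow> \<sigma> \<one>\<^bsub>G\<^esub> x = x" using id_eq_one by (metis restrict_apply')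
  show "g \<in> carrier G \<Longrightarrow> h \<in> carrier G \<Longrightarrow> x \<in> carrier M \<Longrightarrow> \<sigma> (g \<otimes>\<^bsub>G\<^esub> h) x = \<sigma> g (\<sigma> h x)"
    by (rule composition_rule)
qed

text \<open>Structure transport along an injection. Injectivity of \<open>E\<close> is defined by test modules on one
  particular type; transport makes it available for every type that embeds into that one.\<close>

definition transport_module :: "('x \<Rightarrow> 't) \<Rightarrow> ('s, 'x) module \<Rightarrow> ('s, 't) module" where
  "transport_module \<iota> M = \<lparr>carrier = \<iota> ` carrier M, monoid.mult = undefined, one = undefined,
     ring.zero = \<iota> \<zero>\<^bsub>M\<^esub>, add = (\<lambda>u v. \<iota> (inv_into UNIV \<iota> u \<oplus>\<^bsub>M\<^esub> inv_into UNIV \<iota> v)),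
     module.smult = (\<lambda>s u. \<iota> (s \<odot>\<^bsub>M\<^esub> inv_into UNIV \<iota> u))\<rparr>"

definition transport_action :: "('x \<Rightarrow> 't) \<Rightarrow> 'x set \<Rightarrow> ('g \<Rightarrow> 'x \<Rightarrow> 'x) \<Rightarrow> 'g \<Rightarrow> 't \<Rightarrow> 't" where
  "transport_action \<iota> C \<tau> g = restrict (\<lambda>u. \<iota> (\<tau> g (inv_into UNIV \<iota> u))) (\<iota> ` C)"

lemma transport_group_ring_module:
  assumes "inj \<iota>" "group_ring_module S G M \<tau>"
  shows "group_ring_module S G (transport_module \<iota> M) (transport_action \<iota> (carrier M) \<tau>)"
proof -
  note D = group_ring_moduleD[OF assms(2)]
  interpret M: module S M by (rule D)
  let ?N = "transport_module \<iota> M"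
  have [simp]: "inv_into UNIV \<iota> (\<iota> x) = x" for x using assms(1) by simp
  have "abelian_group ?N"
  proof (rule abelian_groupI)
    fix u assume "u \<in> carrier ?N"
    then obtain x where "u = \<iota> x" "x \<in> carrier M" by (auto simp: transport_module_def)
    then show "\<exists>y\<in>carrier ?N. y \<oplus>\<^bsub>?N\<^esub> u = \<zero>\<^bsub>?N\<^esub>"
      by (intro bexI[of _ "\<iota> (\<ominus>\<^bsub>M\<^esub> x)"]) (auto simp: transport_module_def M.l_neg)
  qed (auto simp: transport_module_def M.a_ac)
  then have "module S ?N"
    by (intro moduleI) (auto simp: transport_module_def M.smult_l_distr M.smult_r_distr
        M.smult_assoc1 module.axioms(1)[OF D(1)])
  then have "group_ring_module S G ?N (\<lambda>g. restrict (\<lambda>u. \<iota> (\<tau> g (inv_into UNIV \<iota> u))) (carrier ?N))"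
    by (rule group_ring_moduleI) (use D in \<open>auto simp: mod_hom_def transport_module_def\<close>)
  moreover have "carrier ?N = \<iota> ` carrier M" by (simp add: transport_module_def)
  ultimately show ?thesis by (simp add: transport_action_def[abs_def])
qed

lemma injective_module_extension:
  fixes S :: "('s, 'x) ring_scheme" and G :: "('g, 'y) monoid_scheme"
    and E :: "('s, 'm) module" and A B :: "('s, 't) module" and \<iota> :: "'t \<Rightarrow> 'g \<Rightarrow> 's + 'm"
  assumes "injective_module S G E \<sigma>" "inj \<iota>"
    and "group_ring_module S G A \<alpha>" "group_ring_module S G B \<beta>"
    and "j \<in> group_ring_hom S G A \<alpha> B \<beta>" "inj_on j (carrier A)"
    and "f \<in> group_ring_hom S G A \<alpha> E \<sigma>"
  shows "\<exists>h \<in> group_ring_hom S G B \<beta> E \<sigma>. \<forall>a \<in> carrier A. h (j a) = f a"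
proof -
  let ?A = "transport_module \<iota> A" and ?B = "transport_module \<iota> B"
  let ?\<alpha> = "transport_action \<iota> (carrier A) \<alpha>" and ?\<beta> = "transport_action \<iota> (carrier B) \<beta>"
  let ?j = "\<lambda>u. \<iota> (j (inv_into UNIV \<iota> u))" and ?f = "\<lambda>u. f (inv_into UNIV \<iota> u)"
  have [simp]: "inv_into UNIV \<iota> (\<iota> x) = x" for x using assms(2) by simp
  note A = group_ring_moduleD[OF assms(3)] and B = group_ring_moduleD[OF assms(4)]
  interpret A: module S A by (rule A)
  interpret B: module S B by (rule B)
  have "?j \<in> group_ring_hom S G ?A ?\<alpha> ?B ?\<beta>"
    using assms(5) A B unfolding group_ring_hom_def mod_hom_def
    by (auto simp: transport_module_def transport_action_def)
  moreover have "inj_on ?j (carrier ?A)"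
    using assms(6) injD[OF assms(2)] by (auto simp: transport_module_def inj_on_def)
  moreover have "?f \<in> group_ring_hom S G ?A ?\<alpha> E \<sigma>"
    using assms(7) A unfolding group_ring_hom_def mod_hom_def
    by (auto simp: transport_module_def transport_action_def)
  ultimately have "\<exists>h \<in> group_ring_hom S G ?B ?\<beta> E \<sigma>. \<forall>a \<in> carrier ?A. h (?j a) = ?f a"
    using assms(1) transport_group_ring_module[OF assms(2,3)] transport_group_ring_module[OF assms(2,4)]
    unfolding injective_module_def by blast
  then obtain h where h: "h \<in> group_ring_hom S G ?B ?\<beta> E \<sigma>" "\<forall>a \<in> carrier ?A. h (?j a) = ?f a"
    by blast
  have "h \<circ> \<iota> \<in> group_ring_hom S G B \<beta> E \<sigma>"
    using h(1) B unfolding group_ring_hom_def mod_hom_def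
    by (auto simp: transport_module_def transport_action_def)
  moreover have "\<forall>a \<in> carrier A. (h \<circ> \<iota>) (j a) = f a"
    using h(2) by (auto simp: transport_module_def)
  ultimately show ?thesis by blast
qed

text \<open>The twisted modules below live on pairs. An infinite type is equipotent to its square, and
  adding \<open>'s\<close> to \<open>'m\<close> makes the type infinite even if \<open>'m\<close> is finite.\<close>

lemma prod_embeds_in_functions:
  assumes "infinite (UNIV :: 's set)"
  shows "\<exists>\<iota> :: 'm \<times> 'm \<Rightarrow> 'g \<Rightarrow> 's + 'm. inj \<iota>"
proof -
  let ?T = "UNIV :: ('s + 'm) set"
  have "infinite ?T" using assms by (metis finite_Plus_UNIV_iff)
  then have "|?T \<times> ?T| \<le>o |?T|"
    using card_of_Times_same_infinite ordIso_imp_ordLeq by blast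
  then obtain k :: "('s + 'm) \<times> ('s + 'm) \<Rightarrow> 's + 'm" where k: "inj k"
    by (metis UNIV_Times_UNIV card_of_ordLeq)
  have "inj (\<lambda>(x :: 'm, y :: 'm). (\<lambda>_ :: 'g. k (Inr x, Inr y)))"
    by (auto simp: inj_def dest: fun_cong injD[OF k])
  then show ?thesis by blast
qed

section \<open>Cartan operators and twisted modules\<close>

text \<open>An \<open>S[G]\<close>-submodule, given by its carrier.\<close>

definition stable_submodule ::
    "('s, 'x) ring_scheme \<Rightarrow> ('g, 'y) monoid_scheme \<Rightarrow> ('s, 'm) module \<Rightarrow> ('g \<Rightarrow> 'm \<Rightarrow> 'm) \<Rightarrow> 'm set \<Rightarrow> bool"
  where "stable_submodule S G M \<rho> A \<longleftrightarrow> submodule A S M \<and> (\<forall>g \<in> carrier G. \<forall>x \<in> A. \<rho> g x \<in> A)"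

lemma stable_submodule_carrier:
  assumes "group_ring_module S G M \<rho>"
  shows "stable_submodule S G M \<rho> (carrier M)"
  using group_ring_moduleD[OF assms] module.carrier_is_submodule by (auto simp: stable_submodule_def)

lemma stable_submoduleD:
  assumes "group_ring_module S G M \<rho>" "stable_submodule S G M \<rho> A"
  shows "\<And>x. x \<in> A \<Longrightarrow> x \<in> carrier M" "\<zero>\<^bsub>M\<^esub> \<in> A" "x \<in> A \<Longrightarrow> y \<in> A \<Longrightarrow> x \<oplus>\<^bsub>M\<^esub> y \<in> A"
    "x \<in> A \<Longrightarrow> \<ominus>\<^bsub>M\<^esub> x \<in> A" "s \<in> carrier S \<Longrightarrow> x \<in> A \<Longrightarrow> s \<odot>\<^bsub>M\<^esub> x \<in> A"
    "g \<in> carrier G \<Longrightarrow> x \<in> A \<Longrightarrow> \<rho> g x \<in> A"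
proof -
  interpret M: module S M using group_ring_moduleD(1)[OF assms(1)] .
  have A: "submodule A S M" using assms(2) by (simp add: stable_submodule_def)
  interpret A: submodule A S M by fact
  note E = M.submoduleE[OF A]
  show "\<And>x. x \<in> A \<Longrightarrow> x \<in> carrier M" using E(1) by blast
  show "\<zero>\<^bsub>M\<^esub> \<in> A" using A.one_closed by simp
  show "x \<in> A \<Longrightarrow> y \<in> A \<Longrightarrow> x \<oplus>\<^bsub>M\<^esub> y \<in> A" "x \<in> A \<Longrightarrow> \<ominus>\<^bsub>M\<^esub> x \<in> A"
    "s \<in> carrier S \<Longrightarrow> x \<in> A \<Longrightarrow> s \<odot>\<^bsub>M\<^esub> x \<in> A" using E by auto
  show "g \<in> carrier G \<Longrightarrow> x \<in> A \<Longrightarrow> \<rho> g x \<in> A" using assms(2) by (simp add: stable_submodule_def)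
qed

text \<open>What the argument needs to know about the Steenrod operators: \<open>\<Sum>\<^sub>a P\<^sup>a \<xi>\<^sup>a\<close> is a ring homomorphism
  \<open>S \<rightarrow> S[[\<xi>]]\<close> that is the identity modulo \<open>\<xi>\<close>.\<close>

locale cartan_ring = cring S for S :: "('s, 'x) ring_scheme" (structure) +
  fixes P :: "nat \<Rightarrow> 's \<Rightarrow> 's"
  assumes P_closed [simp]: "s \<in> carrier S \<Longrightarrow> P a s \<in> carrier S"
    and P_add: "s \<in> carrier S \<Longrightarrow> t \<in> carrier S \<Longrightarrow> P a (s \<oplus> t) = P a s \<oplus> P a t"
    and P_mult: "s \<in> carrier S \<Longrightarrow> t \<in> carrier S \<Longrightarrow>
                   P m (s \<otimes> t) = (\<Oplus>a\<in>{..m}. P a s \<otimes> P (m - a) t)"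
    and P_one: "P (Suc a) \<one> = \<zero>"
    and P_0: "s \<in> carrier S \<Longrightarrow> P 0 s = s"
begin

text \<open>The operator \<open>q m\<close> is additive and equivariant on \<open>A\<close> and satisfies the Cartan formula of
  degree \<open>m\<close>. That formula involves \<open>q 0, \<dots>, q m\<close>, hence the whole family is an argument. The
  values may lie outside \<open>A\<close>, since \<open>A\<close> will be a submodule on which the operators are already
  known as maps into \<open>M\<close>.\<close>

definition cartan_op :: "('g, 'y) monoid_scheme \<Rightarrow> ('s, 'm) module \<Rightarrow> ('g \<Rightarrow> 'm \<Rightarrow> 'm) \<Rightarrow> 'm set
    \<Rightarrow> (nat \<Rightarrow> 'm \<Rightarrow> 'm) \<Rightarrow> nat \<Rightarrow> bool" where
  "cartan_op G M \<rho> A q m \<longleftrightarrow>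
     (\<forall>x\<in>A. q m x \<in> carrier M) \<and>
     (\<forall>x\<in>A. \<forall>y\<in>A. q m (x \<oplus>\<^bsub>M\<^esub> y) = q m x \<oplus>\<^bsub>M\<^esub> q m y) \<and>
     (\<forall>g\<in>carrier G. \<forall>x\<in>A. q m (\<rho> g x) = \<rho> g (q m x)) \<and>
     (\<forall>s\<in>carrier S. \<forall>x\<in>A. q m (s \<odot>\<^bsub>M\<^esub> x) = (\<Oplus>\<^bsub>M\<^esub>a\<in>{..m}. P a s \<odot>\<^bsub>M\<^esub> q (m - a) x))"

text \<open>The part of the Cartan formula of degree \<open>n + 1\<close> for \<open>s x\<close> in which operators of degree at
  most \<open>n\<close> are applied to \<open>x\<close>; the remaining summand is \<open>s q\<^sup>n\<^sup>+\<^sup>1(x)\<close>. It is the cocycle \<open>c\<^sub>s(x)\<close>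
  of the introduction.\<close>

definition twist :: "('s, 'm) module \<Rightarrow> (nat \<Rightarrow> 'm \<Rightarrow> 'm) \<Rightarrow> nat \<Rightarrow> 's \<Rightarrow> 'm \<Rightarrow> 'm" where
  "twist M q n s x = (\<Oplus>\<^bsub>M\<^esub>a\<in>{..n}. P (Suc a) s \<odot>\<^bsub>M\<^esub> q (n - a) x)"

text \<open>The extension of \<open>A\<close> by \<open>M\<close> with cocycle \<open>twist\<close>. Operators of degree \<open>n + 1\<close> on \<open>A\<close> correspond
  to its \<open>S[G]\<close>-linear retractions onto \<open>M\<close>.\<close>

definition twisted_module :: "('s, 'm) module \<Rightarrow> 'm set \<Rightarrow> (nat \<Rightarrow> 'm \<Rightarrow> 'm) \<Rightarrow> nat \<Rightarrow> ('s, 'm \<times> 'm) module" where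
  "twisted_module M A q n = \<lparr>carrier = carrier M \<times> A, monoid.mult = undefined, one = undefined,
     ring.zero = (\<zero>\<^bsub>M\<^esub>, \<zero>\<^bsub>M\<^esub>), add = (\<lambda>u v. (fst u \<oplus>\<^bsub>M\<^esub> fst v, snd u \<oplus>\<^bsub>M\<^esub> snd v)),
     module.smult = (\<lambda>s u. (s \<odot>\<^bsub>M\<^esub> fst u \<oplus>\<^bsub>M\<^esub> twist M q n s (snd u), s \<odot>\<^bsub>M\<^esub> snd u))\<rparr>"

definition twisted_action :: "('s, 'm) module \<Rightarrow> 'm set \<Rightarrow> ('g \<Rightarrow> 'm \<Rightarrow> 'm) \<Rightarrow> 'g \<Rightarrow> 'm \<times> 'm \<Rightarrow> 'm \<times> 'm" where
  "twisted_action M A \<rho> g = restrict (\<lambda>u. (\<rho> g (fst u), \<rho> g (snd u))) (carrier M \<times> A)"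

lemma cartan_opD:
  assumes "cartan_op G M \<rho> A q m"
  shows "x \<in> A \<Longrightarrow> q m x \<in> carrier M"
    and "x \<in> A \<Longrightarrow> y \<in> A \<Longrightarrow> q m (x \<oplus>\<^bsub>M\<^esub> y) = q m x \<oplus>\<^bsub>M\<^esub> q m y"
    and "g \<in> carrier G \<Longrightarrow> x \<in> A \<Longrightarrow> q m (\<rho> g x) = \<rho> g (q m x)"
    and "s \<in> carrier S \<Longrightarrow> x \<in> A \<Longrightarrow> q m (s \<odot>\<^bsub>M\<^esub> x) = (\<Oplus>\<^bsub>M\<^esub>a\<in>{..m}. P a s \<odot>\<^bsub>M\<^esub> q (m - a) x)"
  using assms unfolding cartan_op_def by blast+

context
  fixes G :: "('g, 'y) monoid_scheme" and M :: "('s, 'm) module" and \<rho> A q n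
  assumes M: "group_ring_module S G M \<rho>" and A: "stable_submodule S G M \<rho> A"
    and q: "\<And>k. k \<le> n \<Longrightarrow> cartan_op G M \<rho> A q k"
begin

interpretation M: module S M using group_ring_moduleD(1)[OF M] .

lemma twist_closed: "s \<in> carrier S \<Longrightarrow> x \<in> A \<Longrightarrow> twist M q n s x \<in> carrier M"
  unfolding twist_def using cartan_opD(1)[OF q] by (auto intro!: M.finsum_closed)

lemma twist_add_right:
  assumes "s \<in> carrier S" "x \<in> A" "y \<in> A"
  shows "twist M q n s (x \<oplus>\<^bsub>M\<^esub> y) = twist M q n s x \<oplus>\<^bsub>M\<^esub> twist M q n s y"
proof -
  have "twist M q n s (x \<oplus>\<^bsub>M\<^esub> y)
      = (\<Oplus>\<^bsub>M\<^esub>a\<in>{..n}. P (Suc a) s \<odot>\<^bsub>M\<^esub> q (n - a) x \<oplus>\<^bsub>M\<^esub> P (Suc a) s \<odot>\<^bsub>M\<^esub> q (n - a) y)"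
    unfolding twist_def
    by (rule M.finsum_cong') (use assms cartan_opD(1,2)[OF q] in \<open>auto simp: M.smult_r_distr\<close>)
  also have "\<dots> = twist M q n s x \<oplus>\<^bsub>M\<^esub> twist M q n s y"
    unfolding twist_def
    by (rule M.finsum_addf) (use assms cartan_opD(1)[OF q] in auto)
  finally show ?thesis .
qed

lemma twist_add_left:
  assumes "s \<in> carrier S" "t \<in> carrier S" "x \<in> A"
  shows "twist M q n (s \<oplus> t) x = twist M q n s x \<oplus>\<^bsub>M\<^esub> twist M q n t x"
proof -
  have "twist M q n (s \<oplus> t) x
      = (\<Oplus>\<^bsub>M\<^esub>a\<in>{..n}. P (Suc a) s \<odot>\<^bsub>M\<^esub> q (n - a) x \<oplus>\<^bsub>M\<^esub> P (Suc a) t \<odot>\<^bsub>M\<^esub> q (n - a) x)"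
    unfolding twist_def
    by (rule M.finsum_cong') (use assms cartan_opD(1)[OF q] in \<open>auto simp: M.smult_l_distr P_add\<close>)
  also have "\<dots> = twist M q n s x \<oplus>\<^bsub>M\<^esub> twist M q n t x"
    unfolding twist_def
    by (rule M.finsum_addf) (use assms cartan_opD(1)[OF q] in auto)
  finally show ?thesis .
qed

lemma twist_one: "x \<in> A \<Longrightarrow> twist M q n \<one> x = \<zero>\<^bsub>M\<^esub>"
  unfolding twist_def P_one using cartan_opD(1)[OF q]
  by (subst M.finsum_cong'[where g = "\<lambda>_. \<zero>\<^bsub>M\<^esub>"]) auto

lemma twist_action:
  assumes "g \<in> carrier G" "s \<in> carrier S" "x \<in> A"
  shows "twist M q n s (\<rho> g x) = \<rho> g (twist M q n s x)"
proof -
  note D = group_ring_moduleD[OF M]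
  have "\<rho> g (twist M q n s x) = (\<Oplus>\<^bsub>M\<^esub>a\<in>{..n}. \<rho> g (P (Suc a) s \<odot>\<^bsub>M\<^esub> q (n - a) x))"
    unfolding twist_def
    by (rule additive_finsum[OF M.abelian_group_axioms M.abelian_group_axioms])
       (use assms D cartan_opD(1)[OF q] in auto)
  also have "\<dots> = twist M q n s (\<rho> g x)"
    unfolding twist_def
    by (rule M.finsum_cong') (use assms D cartan_opD(1,3)[OF q] stable_submoduleD(6)[OF M A] in auto)
  finally show ?thesis ..
qed

text \<open>The cocycle identity, which is the associativity of the twisted multiplication. Split off the
  summand \<open>s P\<^sup>a\<^sup>+\<^sup>1(t)\<close> from \<open>P\<^sup>a\<^sup>+\<^sup>1(s t)\<close>. These summands give \<open>s c\<^sub>t(x)\<close>, and the rest is, after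
  summation along rows instead of diagonals, \<open>c\<^sub>s\<close> applied to the Cartan formula for \<open>t x\<close>.\<close>

lemma twist_mult:
  assumes "s \<in> carrier S" "t \<in> carrier S" "x \<in> A"
  shows "twist M q n (s \<otimes> t) x = s \<odot>\<^bsub>M\<^esub> twist M q n t x \<oplus>\<^bsub>M\<^esub> twist M q n s (t \<odot>\<^bsub>M\<^esub> x)"
proof -
  note q_closed [simp] = cartan_opD(1)[OF q]
  let ?f = "\<lambda>i j. P (Suc i) s \<odot>\<^bsub>M\<^esub> (P j t \<odot>\<^bsub>M\<^esub> q (n - (i + j)) x)"
  have f_closed: "?f i j \<in> carrier M" if "i + j \<le> n" for i j using that assms by simp
  have split: "P (Suc a) (s \<otimes> t) \<odot>\<^bsub>M\<^esub> q (n - a) x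
      = s \<odot>\<^bsub>M\<^esub> (P (Suc a) t \<odot>\<^bsub>M\<^esub> q (n - a) x) \<oplus>\<^bsub>M\<^esub> (\<Oplus>\<^bsub>M\<^esub>i\<in>{..a}. ?f i (a - i))"
    if "a \<le> n" for a
  proof -
    have "P (Suc a) (s \<otimes> t) = (\<Oplus>i\<in>{..a}. P (Suc i) s \<otimes> P (a - i) t) \<oplus> s \<otimes> P (Suc a) t"
      unfolding P_mult[OF assms(1,2)] by (subst finsum_Suc2) (use assms P_0 in auto)
    then have "P (Suc a) (s \<otimes> t) \<odot>\<^bsub>M\<^esub> q (n - a) x
        = (\<Oplus>i\<in>{..a}. P (Suc i) s \<otimes> P (a - i) t) \<odot>\<^bsub>M\<^esub> q (n - a) x
          \<oplus>\<^bsub>M\<^esub> (s \<otimes> P (Suc a) t) \<odot>\<^bsub>M\<^esub> q (n - a) x"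
      using assms by (simp add: M.smult_l_distr Pi_def finsum_closed)
    also have "(\<Oplus>i\<in>{..a}. P (Suc i) s \<otimes> P (a - i) t) \<odot>\<^bsub>M\<^esub> q (n - a) x
        = (\<Oplus>\<^bsub>M\<^esub>i\<in>{..a}. (P (Suc i) s \<otimes> P (a - i) t) \<odot>\<^bsub>M\<^esub> q (n - a) x)"
      by (rule additive_finsum[where h = "\<lambda>r. r \<odot>\<^bsub>M\<^esub> q (n - a) x"])
         (use assms M.smult_l_distr is_abelian_group M.abelian_group_axioms in auto)
    also have "\<dots> = (\<Oplus>\<^bsub>M\<^esub>i\<in>{..a}. ?f i (a - i))"
      by (rule M.finsum_cong') (use assms that in \<open>auto simp: M.smult_assoc1\<close>)
    finally show ?thesis
      using assms that f_closed
      by (simp add: M.smult_assoc1 M.a_comm Pi_def M.finsum_closed)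
  qed
  have inner: "P (Suc i) s \<odot>\<^bsub>M\<^esub> q (n - i) (t \<odot>\<^bsub>M\<^esub> x) = (\<Oplus>\<^bsub>M\<^esub>j\<in>{..n - i}. ?f i j)" if "i \<le> n" for i
  proof -
    have "q (n - i) (t \<odot>\<^bsub>M\<^esub> x) = (\<Oplus>\<^bsub>M\<^esub>j\<in>{..n - i}. P j t \<odot>\<^bsub>M\<^esub> q (n - i - j) x)"
      using cartan_opD(4)[OF q assms(2,3)] by simp
    also have "P (Suc i) s \<odot>\<^bsub>M\<^esub> \<dots> = (\<Oplus>\<^bsub>M\<^esub>j\<in>{..n - i}. P (Suc i) s \<odot>\<^bsub>M\<^esub> (P j t \<odot>\<^bsub>M\<^esub> q (n - i - j) x))"
      using assms by (intro M.finsum_smult_ldistr) auto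
    finally show ?thesis by simp
  qed
  have "twist M q n (s \<otimes> t) x
      = (\<Oplus>\<^bsub>M\<^esub>a\<in>{..n}. s \<odot>\<^bsub>M\<^esub> (P (Suc a) t \<odot>\<^bsub>M\<^esub> q (n - a) x) \<oplus>\<^bsub>M\<^esub> (\<Oplus>\<^bsub>M\<^esub>i\<in>{..a}. ?f i (a - i)))"
    unfolding twist_def
    by (rule M.finsum_cong') (use split assms f_closed in \<open>auto intro!: M.finsum_closed M.a_closed\<close>)
  also have "\<dots> = (\<Oplus>\<^bsub>M\<^esub>a\<in>{..n}. s \<odot>\<^bsub>M\<^esub> (P (Suc a) t \<odot>\<^bsub>M\<^esub> q (n - a) x))
      \<oplus>\<^bsub>M\<^esub> (\<Oplus>\<^bsub>M\<^esub>a\<in>{..n}. \<Oplus>\<^bsub>M\<^esub>i\<in>{..a}. ?f i (a - i))"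
    by (rule M.finsum_addf) (use assms f_closed in \<open>auto intro!: M.finsum_closed\<close>)
  also have "(\<Oplus>\<^bsub>M\<^esub>a\<in>{..n}. s \<odot>\<^bsub>M\<^esub> (P (Suc a) t \<odot>\<^bsub>M\<^esub> q (n - a) x)) = s \<odot>\<^bsub>M\<^esub> twist M q n t x"
    unfolding twist_def using assms by (intro M.finsum_smult_ldistr[symmetric]) auto
  also have "(\<Oplus>\<^bsub>M\<^esub>a\<in>{..n}. \<Oplus>\<^bsub>M\<^esub>i\<in>{..a}. ?f i (a - i)) = (\<Oplus>\<^bsub>M\<^esub>i\<in>{..n}. \<Oplus>\<^bsub>M\<^esub>j\<in>{..n - i}. ?f i j)"
    by (rule M.finsum_triangle) (rule f_closed)
  also have "\<dots> = twist M q n s (t \<odot>\<^bsub>M\<^esub> x)"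
    unfolding twist_def
    by (rule M.finsum_cong')
       (use inner assms stable_submoduleD(5)[OF M A] in auto)
  finally show ?thesis .
qed

lemma twisted_group_ring_module:
  "group_ring_module S G (twisted_module M A q n) (twisted_action M A \<rho>)"
proof -
  note D = group_ring_moduleD[OF M] and [simp] = stable_submoduleD[OF M A]
  note [simp] = twist_closed twist_one
  let ?X = "twisted_module M A q n"
  have "abelian_group ?X"
  proof (rule abelian_groupI)
    fix u assume "u \<in> carrier ?X"
    then show "\<exists>v\<in>carrier ?X. v \<oplus>\<^bsub>?X\<^esub> u = \<zero>\<^bsub>?X\<^esub>"
      by (intro bexI[of _ "(\<ominus>\<^bsub>M\<^esub> fst u, \<ominus>\<^bsub>M\<^esub> snd u)"]) (auto simp: twisted_module_def M.l_neg)
  qed (auto simp: twisted_module_def M.a_ac)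
  then have "module S ?X"
  proof (intro moduleI)
    fix s t u assume "s \<in> carrier S" "t \<in> carrier S" "u \<in> carrier ?X"
    then show "(s \<oplus> t) \<odot>\<^bsub>?X\<^esub> u = (s \<odot>\<^bsub>?X\<^esub> u) \<oplus>\<^bsub>?X\<^esub> (t \<odot>\<^bsub>?X\<^esub> u)"
      by (auto simp: twisted_module_def M.smult_l_distr twist_add_left M.a_ac)
  next
    fix s u v assume "s \<in> carrier S" "v \<in> carrier ?X" "u \<in> carrier ?X"
    then show "s \<odot>\<^bsub>?X\<^esub> (u \<oplus>\<^bsub>?X\<^esub> v) = (s \<odot>\<^bsub>?X\<^esub> u) \<oplus>\<^bsub>?X\<^esub> (s \<odot>\<^bsub>?X\<^esub> v)"
      by (auto simp: twisted_module_def M.smult_r_distr twist_add_right M.a_ac)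
  next
    fix s t u assume "s \<in> carrier S" "t \<in> carrier S" "u \<in> carrier ?X"
    then show "(s \<otimes> t) \<odot>\<^bsub>?X\<^esub> u = s \<odot>\<^bsub>?X\<^esub> (t \<odot>\<^bsub>?X\<^esub> u)"
      by (auto simp: twisted_module_def M.smult_r_distr M.smult_assoc1 twist_mult M.a_ac)
  qed (auto simp: twisted_module_def is_cring)
  then have "group_ring_module S G ?X (\<lambda>g. restrict (\<lambda>u. (\<rho> g (fst u), \<rho> g (snd u))) (carrier ?X))"
    by (rule group_ring_moduleI) (use D in \<open>auto simp: mod_hom_def twisted_module_def twist_action\<close>)
  moreover have "carrier ?X = carrier M \<times> A" by (simp add: twisted_module_def)
  ultimately show ?thesis by (simp add: twisted_action_def[abs_def])
qed

end

lemma cartan_sum_Suc: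
  assumes "module S M" "\<And>k. k \<le> n \<Longrightarrow> cartan_op G M \<rho> A q k" "\<And>x. x \<in> A \<Longrightarrow> f x \<in> carrier M"
    and "s \<in> carrier S" "x \<in> A"
  shows "(\<Oplus>\<^bsub>M\<^esub>a\<in>{..Suc n}. P a s \<odot>\<^bsub>M\<^esub> (q(Suc n := f)) (Suc n - a) x)
      = s \<odot>\<^bsub>M\<^esub> f x \<oplus>\<^bsub>M\<^esub> twist M q n s x"
proof -
  interpret M: module S M by fact
  have "(\<Oplus>\<^bsub>M\<^esub>a\<in>{..n}. P (Suc a) s \<odot>\<^bsub>M\<^esub> (q(Suc n := f)) (n - a) x) = twist M q n s x"
    unfolding twist_def
    by (rule M.finsum_cong') (use assms cartan_opD(1)[OF assms(2)] in auto)
  then show ?thesis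
    using assms cartan_opD(1)[OF assms(2)]
    by (subst M.finsum_Suc2) (auto simp: P_0 twist_def M.finsum_closed intro!: M.a_comm)
qed

end

section \<open>Extending Cartan families to injective modules\<close>

context cartan_ring
begin

text \<open>The formula of degree \<open>m\<close> sees only the operators of degree at most \<open>m\<close>.\<close>

lemma cartan_op_cong:
  assumes "\<And>j. j \<le> m \<Longrightarrow> q' j = q j"
  shows "cartan_op G M \<rho> A q' m \<longleftrightarrow> cartan_op G M \<rho> A q m"
  using assms by (simp add: cartan_op_def)

lemma cartan_op_subset:
  "cartan_op G M \<rho> B q m \<Longrightarrow> A \<subseteq> B \<Longrightarrow> cartan_op G M \<rho> A q m"
  unfolding cartan_op_def by blast

text \<open>The heart of the proof. The map \<open>F (e, a) = e - r a\<close> is linear on the twisted module over \<open>A\<close>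
  because \<open>r\<close> satisfies the Cartan formula. An extension \<open>h\<close> of \<open>F\<close> to the twisted module over \<open>E\<close>
  is the identity on \<open>E \<times> 0\<close>, so linearity of \<open>h\<close> read backwards is the Cartan formula for
  \<open>- h (0, b)\<close>.\<close>

lemma cartan_extension_step:
  fixes G :: "('g, 'y) monoid_scheme" and E :: "('s, 'm) module"
  assumes inf: "infinite (UNIV :: 's set)" and E: "injective_module S G E \<rho>"
    and A: "stable_submodule S G E \<rho> A"
    and q: "\<And>k. k \<le> n \<Longrightarrow> cartan_op G E \<rho> (carrier E) q k"
    and r: "cartan_op G E \<rho> A (q(Suc n := r)) (Suc n)"
  shows "\<exists>h. cartan_op G E \<rho> (carrier E) (q(Suc n := h)) (Suc n) \<and> (\<forall>a\<in>A. h a = r a)"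
proof -
  have M: "group_ring_module S G E \<rho>" using E by (simp add: injective_module_def)
  note D = group_ring_moduleD[OF M] and A' = stable_submoduleD[OF M A]
  interpret M: module S E by (rule D)
  have qA: "cartan_op G E \<rho> A q k" if "k \<le> n" for k
    using cartan_op_subset[OF q[OF that], of A] A'(1) by blast
  have r_closed: "r x \<in> carrier E" if "x \<in> A" for x using cartan_opD(1)[OF r that] by simp
  have r_add: "r (x \<oplus>\<^bsub>E\<^esub> y) = r x \<oplus>\<^bsub>E\<^esub> r y" if "x \<in> A" "y \<in> A" for x y
    using cartan_opD(2)[OF r that] by simp
  have r_act: "r (\<rho> g x) = \<rho> g (r x)" if "g \<in> carrier G" "x \<in> A" for g x
    using cartan_opD(3)[OF r that] by simp
  have r_smult: "r (s \<odot>\<^bsub>E\<^esub> x) = s \<odot>\<^bsub>E\<^esub> r x \<oplus>\<^bsub>E\<^esub> twist E q n s x" if "s \<in> carrier S" "x \<in> A" for s x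
    using cartan_opD(4)[OF r that] cartan_sum_Suc[OF D(1) qA r_closed that] by simp
  have r_zero: "r \<zero>\<^bsub>E\<^esub> = \<zero>\<^bsub>E\<^esub>"
    using r_add[OF A'(2) A'(2)] r_closed[OF A'(2)] by (metis M.l_zero M.zero_closed M.add.r_cancel_one)
  have act_zero: "\<rho> g \<zero>\<^bsub>E\<^esub> = \<zero>\<^bsub>E\<^esub>" if "g \<in> carrier G" for g
    by (rule additive_zero[OF M.abelian_group_axioms M.abelian_group_axioms]) (use D that in auto)
  have act_minus: "\<rho> g (\<ominus>\<^bsub>E\<^esub> x) = \<ominus>\<^bsub>E\<^esub> \<rho> g x" if "g \<in> carrier G" "x \<in> carrier E" for g x
    using that D(3) D(4)[OF that(1), of "\<ominus>\<^bsub>E\<^esub> x" x] act_zero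
    by (intro M.minus_equality[symmetric]) (auto simp: M.l_neg)
  let ?XA = "twisted_module E A q n" and ?XE = "twisted_module E (carrier E) q n"
  let ?\<tau>A = "twisted_action E A \<rho>" and ?\<tau>E = "twisted_action E (carrier E) \<rho>"
  define F where "F = (\<lambda>u. fst u \<oplus>\<^bsub>E\<^esub> \<ominus>\<^bsub>E\<^esub> r (snd u))"
  note tw = twist_closed[OF M A qA] twist_closed[OF M stable_submodule_carrier[OF M] q]
  have F: "F \<in> group_ring_hom S G ?XA ?\<tau>A E \<rho>"
    unfolding group_ring_hom_def mod_hom_def
    using A' D r_closed tw
    by (auto simp: twisted_module_def twisted_action_def F_def r_add r_act r_smult act_minus
        M.smult_r_distr M.smult_r_minus M.minus_add M.a_ac M.r_neg M.r_neg1 M.r_neg2)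
  have incl: "id \<in> group_ring_hom S G ?XA ?\<tau>A ?XE ?\<tau>E" "inj_on id (carrier ?XA)"
    unfolding group_ring_hom_def mod_hom_def using A'(1)
    by (auto simp: twisted_module_def twisted_action_def)
  obtain \<iota> :: "'m \<times> 'm \<Rightarrow> 'g \<Rightarrow> 's + 'm" where \<iota>: "inj \<iota>"
    using prod_embeds_in_functions[OF inf] by blast
  obtain h where h: "h \<in> group_ring_hom S G ?XE ?\<tau>E E \<rho>" "\<And>u. u \<in> carrier ?XA \<Longrightarrow> h u = F u"
    using injective_module_extension[OF E \<iota> twisted_group_ring_module[OF M A qA]
        twisted_group_ring_module[OF M stable_submodule_carrier[OF M] q] incl F] by auto
  have h_closed: "h (e, b) \<in> carrier E" if "e \<in> carrier E" "b \<in> carrier E" for e b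
    using h(1) that by (auto simp: group_ring_hom_def mod_hom_def twisted_module_def)
  have h_add: "h (e \<oplus>\<^bsub>E\<^esub> e', b \<oplus>\<^bsub>E\<^esub> b') = h (e, b) \<oplus>\<^bsub>E\<^esub> h (e', b')"
    if "e \<in> carrier E" "b \<in> carrier E" "e' \<in> carrier E" "b' \<in> carrier E" for e b e' b'
    using h(1) that by (auto simp: group_ring_hom_def mod_hom_def twisted_module_def)
  have h_act: "h (\<rho> g e, \<rho> g b) = \<rho> g (h (e, b))"
    if "g \<in> carrier G" "e \<in> carrier E" "b \<in> carrier E" for g e b
    using h(1) that by (auto simp: group_ring_hom_def twisted_module_def twisted_action_def)
  have h_smult: "h (s \<odot>\<^bsub>E\<^esub> e \<oplus>\<^bsub>E\<^esub> twist E q n s b, s \<odot>\<^bsub>E\<^esub> b) = s \<odot>\<^bsub>E\<^esub> h (e, b)"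
    if "s \<in> carrier S" "e \<in> carrier E" "b \<in> carrier E" for s e b
    using h(1) that by (auto simp: group_ring_hom_def mod_hom_def twisted_module_def)
  have h_A: "h (e, a) = e \<oplus>\<^bsub>E\<^esub> \<ominus>\<^bsub>E\<^esub> r a" if "e \<in> carrier E" "a \<in> A" for e a
    using h(2)[of "(e, a)"] that by (simp add: F_def twisted_module_def)
  define k where "k b = \<ominus>\<^bsub>E\<^esub> h (\<zero>\<^bsub>E\<^esub>, b)" for b
  have k_closed: "k b \<in> carrier E" if "b \<in> carrier E" for b using that h_closed by (simp add: k_def)
  have k_smult: "k (s \<odot>\<^bsub>E\<^esub> b) = s \<odot>\<^bsub>E\<^esub> k b \<oplus>\<^bsub>E\<^esub> twist E q n s b"
    if "s \<in> carrier S" "b \<in> carrier E" for s b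
  proof -
    have t: "twist E q n s b \<in> carrier E" using tw(2) that by blast
    have "s \<odot>\<^bsub>E\<^esub> h (\<zero>\<^bsub>E\<^esub>, b) = h (twist E q n s b, s \<odot>\<^bsub>E\<^esub> b)"
      using h_smult[of s "\<zero>\<^bsub>E\<^esub>" b] that t by simp
    also have "\<dots> = h (twist E q n s b, \<zero>\<^bsub>E\<^esub>) \<oplus>\<^bsub>E\<^esub> h (\<zero>\<^bsub>E\<^esub>, s \<odot>\<^bsub>E\<^esub> b)"
      using h_add[of "twist E q n s b" "\<zero>\<^bsub>E\<^esub>" "\<zero>\<^bsub>E\<^esub>" "s \<odot>\<^bsub>E\<^esub> b"] that t by simp
    also have "h (twist E q n s b, \<zero>\<^bsub>E\<^esub>) = twist E q n s b"
      using h_A[OF t A'(2)] t by (simp add: r_zero)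
    finally show ?thesis
      using that t h_closed
      by (simp add: k_def M.smult_r_minus M.minus_add M.a_ac M.r_neg1 M.r_neg M.r_neg2)
  qed
  have "k (b \<oplus>\<^bsub>E\<^esub> b') = k b \<oplus>\<^bsub>E\<^esub> k b'" if "b \<in> carrier E" "b' \<in> carrier E" for b b'
    using h_add[of "\<zero>\<^bsub>E\<^esub>" b "\<zero>\<^bsub>E\<^esub>" b'] that h_closed by (simp add: k_def M.minus_add)
  moreover have "k (\<rho> g b) = \<rho> g (k b)" if "g \<in> carrier G" "b \<in> carrier E" for g b
    using h_act[of g "\<zero>\<^bsub>E\<^esub>" b] that h_closed by (simp add: k_def act_zero act_minus)
  ultimately have "cartan_op G E \<rho> (carrier E) (q(Suc n := k)) (Suc n)"
    unfolding cartan_op_def using k_closed k_smult cartan_sum_Suc[OF D(1) q k_closed] by simp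
  moreover have "k a = r a" if "a \<in> A" for a
    using h_A[of "\<zero>\<^bsub>E\<^esub>" a] that r_closed by (simp add: k_def)
  ultimately show ?thesis by blast
qed

text \<open>Iterating the step over all degrees. Each choice depends on the operators chosen before, but
  never changes them, so the choices converge to one family.\<close>

lemma cartan_extension:
  fixes G :: "('g, 'y) monoid_scheme" and E :: "('s, 'm) module"
  assumes inf: "infinite (UNIV :: 's set)" and E: "injective_module S G E \<rho>"
    and A: "stable_submodule S G E \<rho> A"
    and r: "\<And>m. cartan_op G E \<rho> A r m" and r0: "\<And>a. a \<in> A \<Longrightarrow> r 0 a = a"
  shows "\<exists>q. (\<forall>m. cartan_op G E \<rho> (carrier E) q m) \<and> (\<forall>x\<in>carrier E. q 0 x = x)
    \<and> (\<forall>m. \<forall>a\<in>A. q m a = r m a)"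
proof -
  have M: "group_ring_module S G E \<rho>" using E by (simp add: injective_module_def)
  note D = group_ring_moduleD[OF M] and A' = stable_submoduleD[OF M A]
  interpret M: module S E by (rule D)
  define I where "I n q \<longleftrightarrow> (\<forall>k\<le>n. cartan_op G E \<rho> (carrier E) q k \<and> (\<forall>a\<in>A. q k a = r k a))
      \<and> q 0 = (\<lambda>x. x)" for n q
  have "\<exists>f. \<forall>n. I n (f n) \<and> (\<forall>k\<le>n. f (Suc n) k = f n k)"
  proof (rule dependent_nat_choice)
    show "\<exists>q. I 0 q"
      by (rule exI[of _ "\<lambda>_ x. x"]) (use D in \<open>auto simp: I_def cartan_op_def P_0 r0\<close>)
  next
    fix q n assume q: "I n q"
    have "cartan_op G E \<rho> A (q(Suc n := r (Suc n))) (Suc n)"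
    proof -
      have "(\<Oplus>\<^bsub>E\<^esub>a\<in>{..Suc n}. P a s \<odot>\<^bsub>E\<^esub> (q(Suc n := r (Suc n))) (Suc n - a) x)
          = (\<Oplus>\<^bsub>E\<^esub>a\<in>{..Suc n}. P a s \<odot>\<^bsub>E\<^esub> r (Suc n - a) x)" if "s \<in> carrier S" "x \<in> A" for s x
        by (rule M.finsum_cong') (use that q cartan_opD(1)[OF r] in \<open>auto simp: I_def\<close>)
      then show ?thesis using r[of "Suc n"] by (simp add: cartan_op_def)
    qed
    then obtain h where h: "cartan_op G E \<rho> (carrier E) (q(Suc n := h)) (Suc n)"
        "\<forall>a\<in>A. h a = r (Suc n) a"
      using cartan_extension_step[OF inf E A] q unfolding I_def by blast
    have "I (Suc n) (q(Suc n := h))"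
      unfolding I_def
    proof (intro conjI allI impI)
      fix k assume "k \<le> Suc n"
      then consider "k \<le> n" | "k = Suc n" by linarith
      then show "cartan_op G E \<rho> (carrier E) (q(Suc n := h)) k"
        using q h(1) cartan_op_cong[of k "q(Suc n := h)" q G E \<rho> "carrier E"] by cases (auto simp: I_def)
    qed (use q h in \<open>auto simp: I_def le_Suc_eq\<close>)
    then show "\<exists>q'. I (Suc n) q' \<and> (\<forall>k\<le>n. q' k = q k)" by (intro exI) auto
  qed
  then obtain f where f: "\<And>n. I n (f n)" "\<And>n k. k \<le> n \<Longrightarrow> f (Suc n) k = f n k" by blast
  have stable: "f (n + d) k = f n k" if "k \<le> n" for n d k
    using that by (induction d) (auto simp: f(2))
  \<comment> \<open>The value at \<open>m\<close> is final from stage \<open>m\<close> on.\<close>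
  define q where "q m = f m m" for m
  have q: "q j = f m j" if "j \<le> m" for j m
    using stable[of j j "m - j"] that by (simp add: q_def)
  have "cartan_op G E \<rho> (carrier E) q m" for m
    using f(1)[of m] cartan_op_cong[of m q "f m" G E \<rho> "carrier E"] q by (auto simp: I_def)
  moreover have "q 0 x = x" "q m a = r m a" if "a \<in> A" for x m a
    using f(1)[of 0] f(1)[of m] that by (auto simp: q_def I_def)
  moreover have "q 0 x = x" for x
    using f(1)[of 0] by (auto simp: q_def I_def)
  ultimately show ?thesis by blast
qed

text \<open>A Cartan family that preserves the kernel of \<open>f\<close> descends to the image of \<open>f\<close>, and extends from
  there to the injective module. The closure conditions on \<open>M\<close> are those under which
  the formulas for the image of \<open>f\<close> make sense.\<close>

lemma cartan_lift:
  fixes G :: "('g, 'y) monoid_scheme" and E :: "('s, 'm) module" and M :: "('s, 'a) module"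
  assumes inf: "infinite (UNIV :: 's set)" and E: "injective_module S G E \<tau>"
    and f: "f \<in> group_ring_hom S G M \<rho> E \<tau>"
    and M: "abelian_group M" "\<And>s x. s \<in> carrier S \<Longrightarrow> x \<in> carrier M \<Longrightarrow> s \<odot>\<^bsub>M\<^esub> x \<in> carrier M"
      "\<And>g x. g \<in> carrier G \<Longrightarrow> x \<in> carrier M \<Longrightarrow> \<rho> g x \<in> carrier M"
    and p: "\<And>m. cartan_op G M \<rho> (carrier M) p m" "\<And>x. x \<in> carrier M \<Longrightarrow> p 0 x = x"
    and ker: "\<And>m x. x \<in> a_kernel M E f \<Longrightarrow> p m x \<in> a_kernel M E f"
  shows "\<exists>q. (\<forall>m. cartan_op G E \<tau> (carrier E) q m) \<and> (\<forall>x\<in>carrier E. q 0 x = x)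
    \<and> (\<forall>m. \<forall>x\<in>carrier M. f (p m x) = q m (f x))"
proof -
  have E': "group_ring_module S G E \<tau>" using E by (simp add: injective_module_def)
  note D = group_ring_moduleD[OF E']
  interpret E: module S E by (rule D)
  interpret M: abelian_group M by (rule M)
  have f_closed: "f x \<in> carrier E" if "x \<in> carrier M" for x
    using f that by (auto simp: group_ring_hom_def mod_hom_def)
  have f_add: "f (x \<oplus>\<^bsub>M\<^esub> y) = f x \<oplus>\<^bsub>E\<^esub> f y" if "x \<in> carrier M" "y \<in> carrier M" for x y
    using f that by (auto simp: group_ring_hom_def mod_hom_def)
  have f_smult: "f (s \<odot>\<^bsub>M\<^esub> x) = s \<odot>\<^bsub>E\<^esub> f x" if "s \<in> carrier S" "x \<in> carrier M" for s x
    using f that by (auto simp: group_ring_hom_def mod_hom_def)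
  have f_act: "f (\<rho> g x) = \<tau> g (f x)" if "g \<in> carrier G" "x \<in> carrier M" for g x
    using f that by (auto simp: group_ring_hom_def)
  have f_zero: "f \<zero>\<^bsub>M\<^esub> = \<zero>\<^bsub>E\<^esub>"
    by (rule additive_zero[OF M(1) E.abelian_group_axioms]) (use f_closed f_add in auto)
  have f_minus: "f (\<ominus>\<^bsub>M\<^esub> x) = \<ominus>\<^bsub>E\<^esub> f x" if "x \<in> carrier M" for x
    using that f_closed f_zero f_add[of "\<ominus>\<^bsub>M\<^esub> x" x]
    by (intro E.minus_equality[symmetric]) (auto simp: M.l_neg)
  note p_closed = cartan_opD(1)[OF p(1)] and p_add = cartan_opD(2)[OF p(1)]
  have well_defined: "f (p m x) = f (p m y)" if "x \<in> carrier M" "y \<in> carrier M" "f x = f y" for m x y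
  proof -
    let ?d = "x \<oplus>\<^bsub>M\<^esub> \<ominus>\<^bsub>M\<^esub> y"
    have "?d \<in> a_kernel M E f"
      using that f_closed by (simp add: a_kernel_def' f_add f_minus E.r_neg)
    then have "f (p m ?d) = \<zero>\<^bsub>E\<^esub>" using ker by (auto simp: a_kernel_def')
    moreover have "p m x = p m ?d \<oplus>\<^bsub>M\<^esub> p m y"
      using that p_add[of ?d y m] by (simp add: M.a_assoc M.l_neg)
    ultimately show ?thesis using that p_closed f_closed by (simp add: f_add)
  qed
  let ?A = "f ` carrier M"
  define r where "r m y = f (p m (SOME x. x \<in> carrier M \<and> f x = y))" for m y
  have r: "r m (f x) = f (p m x)" if "x \<in> carrier M" for m x
  proof -
    have "(SOME x'. x' \<in> carrier M \<and> f x' = f x) \<in> carrier M \<and> f (SOME x'. x' \<in> carrier M \<and> f x' = f x) = f x"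
      by (rule someI_ex) (use that in blast)
    then show ?thesis unfolding r_def using well_defined that by blast
  qed
  have "submodule ?A S E"
  proof (rule E.submoduleI)
    show "\<zero>\<^bsub>E\<^esub> \<in> ?A" using f_zero M.zero_closed by (metis imageI)
  next
    fix a assume "a \<in> ?A" then show "\<ominus>\<^bsub>E\<^esub> a \<in> ?A" using f_minus M.a_inv_closed
      by (metis (no_types, lifting) imageE imageI)
  next
    fix a b assume "a \<in> ?A" "b \<in> ?A"
    then show "a \<oplus>\<^bsub>E\<^esub> b \<in> ?A" using f_add M.a_closed by (metis (no_types, lifting) imageE imageI)
  next
    fix s a assume "s \<in> carrier S" "a \<in> ?A"
    then show "s \<odot>\<^bsub>E\<^esub> a \<in> ?A" using f_smult M(2) by (metis (no_types, lifting) imageE imageI)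
  qed (use f_closed in auto)
  moreover have "\<forall>g\<in>carrier G. \<forall>x\<in>?A. \<tau> g x \<in> ?A" using f_act M(3) by force
  ultimately have A: "stable_submodule S G E \<tau> ?A" by (simp add: stable_submodule_def)
  have "cartan_op G E \<tau> ?A r m" for m
    unfolding cartan_op_def
  proof (intro conjI ballI)
    fix y assume "y \<in> ?A"
    then obtain x where x: "x \<in> carrier M" "y = f x" by blast
    show "r m y \<in> carrier E" using x r f_closed p_closed by simp
    { fix y' assume "y' \<in> ?A"
      then obtain x' where x': "x' \<in> carrier M" "y' = f x'" by blast
      show "r m (y \<oplus>\<^bsub>E\<^esub> y') = r m y \<oplus>\<^bsub>E\<^esub> r m y'"
        unfolding x(2) x'(2) f_add[OF x(1) x'(1), symmetric]
        using x x' by (subst r) (auto simp: r p_add p_closed f_add) }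
    { fix g assume g: "g \<in> carrier G"
      show "r m (\<tau> g y) = \<tau> g (r m y)"
        unfolding x(2) f_act[OF g x(1), symmetric]
        using x g M(3) by (subst r) (auto simp: r cartan_opD(3)[OF p(1)] p_closed f_act) }
    { fix s assume s: "s \<in> carrier S"
      have "r m (s \<odot>\<^bsub>E\<^esub> y) = f (\<Oplus>\<^bsub>M\<^esub>a\<in>{..m}. P a s \<odot>\<^bsub>M\<^esub> p (m - a) x)"
        unfolding x(2) f_smult[OF s x(1), symmetric]
        using x s M(2) by (simp add: r cartan_opD(4)[OF p(1)])
      also have "\<dots> = (\<Oplus>\<^bsub>E\<^esub>a\<in>{..m}. f (P a s \<odot>\<^bsub>M\<^esub> p (m - a) x))"
        by (rule additive_finsum[OF M(1) E.abelian_group_axioms])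
           (use f_closed f_add M(2) p_closed x s in auto)
      also have "\<dots> = (\<Oplus>\<^bsub>E\<^esub>a\<in>{..m}. P a s \<odot>\<^bsub>E\<^esub> r (m - a) y)"
        by (rule E.finsum_cong') (use f_closed p_closed x s in \<open>auto simp: f_smult r\<close>)
      finally show "r m (s \<odot>\<^bsub>E\<^esub> y) = (\<Oplus>\<^bsub>E\<^esub>a\<in>{..m}. P a s \<odot>\<^bsub>E\<^esub> r (m - a) y)" . }
  qed
  moreover have "r 0 a = a" if "a \<in> ?A" for a using that r p(2) by auto
  ultimately obtain q where "\<forall>m. cartan_op G E \<tau> (carrier E) q m" "\<forall>x\<in>carrier E. q 0 x = x"
      "\<forall>m. \<forall>a\<in>?A. q m a = r m a"
    using cartan_extension[OF inf E A, of r] by blast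
  then show ?thesis using r by (intro exI[of _ q]) auto
qed

text \<open>Exactness keeps the induction going: the kernel of one differential is the image of the previous
  one, and families that commute with the differentials preserve such images.\<close>

lemma cartan_resolution:
  fixes G :: "('g, 'y) monoid_scheme" and E :: "nat \<Rightarrow> ('s, 'm) module" and M :: "('s, 'a) module"
  assumes inf: "infinite (UNIV :: 's set)" and res: "injective_resolution S G M \<rho> E \<tau> \<epsilon> \<delta>"
    and M: "abelian_group M" "\<And>s x. s \<in> carrier S \<Longrightarrow> x \<in> carrier M \<Longrightarrow> s \<odot>\<^bsub>M\<^esub> x \<in> carrier M"
      "\<And>g x. g \<in> carrier G \<Longrightarrow> x \<in> carrier M \<Longrightarrow> \<rho> g x \<in> carrier M"
    and p: "\<And>m. cartan_op G M \<rho> (carrier M) p m" "\<And>x. x \<in> carrier M \<Longrightarrow> p 0 x = x"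
  shows "\<exists>q. \<forall>n. (\<forall>m. cartan_op G (E n) (\<tau> n) (carrier (E n)) (q n) m) \<and>
    (\<forall>x\<in>carrier (E n). q n 0 x = x) \<and>
    (\<forall>m. \<forall>x\<in>carrier (E n). \<delta> n (q n m x) = q (Suc n) m (\<delta> n x))"
proof -
  have E: "injective_module S G (E n) (\<tau> n)" for n
    using res by (simp add: injective_resolution_def)
  then have E': "group_ring_module S G (E n) (\<tau> n)" for n by (simp add: injective_module_def)
  note D = group_ring_moduleD[OF E']
  interpret M: abelian_group M by (rule M)
  have E_ab: "abelian_group (E n)" for n using D(1)[of n] by (rule module.axioms)
  have eps: "\<epsilon> \<in> group_ring_hom S G M \<rho> (E 0) (\<tau> 0)" "inj_on \<epsilon> (carrier M)"
      "\<epsilon> ` carrier M = a_kernel (E 0) (E (Suc 0)) (\<delta> 0)"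
    and delta: "\<And>n. \<delta> n \<in> group_ring_hom S G (E n) (\<tau> n) (E (Suc n)) (\<tau> (Suc n))"
      "\<And>n. \<delta> n ` carrier (E n) = a_kernel (E (Suc n)) (E (Suc (Suc n))) (\<delta> (Suc n))"
    using res by (auto simp: injective_resolution_def)
  \<comment> \<open>Preservation of the kernel is what makes the family descend to the next image.\<close>
  define I where "I n q \<longleftrightarrow> (\<forall>m. cartan_op G (E n) (\<tau> n) (carrier (E n)) q m) \<and>
      (\<forall>x\<in>carrier (E n). q 0 x = x) \<and>
      (\<forall>m. \<forall>x\<in>a_kernel (E n) (E (Suc n)) (\<delta> n). q m x \<in> a_kernel (E n) (E (Suc n)) (\<delta> n))" for n q
  have "\<exists>f. \<forall>n. I n (f n) \<and> (\<forall>m. \<forall>x\<in>carrier (E n). \<delta> n (f n m x) = f (Suc n) m (\<delta> n x))"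
  proof (rule dependent_nat_choice)
    have eps0: "\<epsilon> \<zero>\<^bsub>M\<^esub> = \<zero>\<^bsub>E 0\<^esub>"
      by (rule additive_zero[OF M(1) E_ab]) (use eps(1) in \<open>auto simp: group_ring_hom_def mod_hom_def\<close>)
    have p0: "p m \<zero>\<^bsub>M\<^esub> = \<zero>\<^bsub>M\<^esub>" for m
      by (rule additive_zero[OF M(1) M(1)]) (use cartan_opD(1,2)[OF p(1)] in auto)
    have ker: "p m x \<in> a_kernel M (E 0) \<epsilon>" if "x \<in> a_kernel M (E 0) \<epsilon>" for m x
    proof -
      have "x \<in> carrier M" "\<epsilon> x = \<epsilon> \<zero>\<^bsub>M\<^esub>" using that eps0 by (simp_all add: a_kernel_def')
      then have "x = \<zero>\<^bsub>M\<^esub>" using inj_onD[OF eps(2)] by blast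
      then show ?thesis using that p0 by simp
    qed
    obtain q where q: "\<forall>m. cartan_op G (E 0) (\<tau> 0) (carrier (E 0)) q m"
       "\<forall>x\<in>carrier (E 0). q 0 x = x" "\<forall>m. \<forall>x\<in>carrier M. \<epsilon> (p m x) = q m (\<epsilon> x)"
      using cartan_lift[OF inf E eps(1) M p ker] by blast
    have "q m x \<in> \<epsilon> ` carrier M" if x: "x \<in> \<epsilon> ` carrier M" for m x
    proof -
      obtain y where "y \<in> carrier M" "x = \<epsilon> y" using x by blast
      then show ?thesis using q(3) cartan_opD(1)[OF p(1)] by (metis imageI)
    qed
    with q show "\<exists>q. I 0 q" unfolding I_def eps(3)[symmetric] by blast
  next
    fix q n assume q: "I n q"
    have q1: "cartan_op G (E n) (\<tau> n) (carrier (E n)) q m" for m using q by (simp add: I_def)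
    have q2: "q 0 x = x" if "x \<in> carrier (E n)" for x using q that by (simp add: I_def)
    have q3: "q m x \<in> a_kernel (E n) (E (Suc n)) (\<delta> n)" if "x \<in> a_kernel (E n) (E (Suc n)) (\<delta> n)" for m x
      using q that by (simp add: I_def)
    obtain q' where q': "\<forall>m. cartan_op G (E (Suc n)) (\<tau> (Suc n)) (carrier (E (Suc n))) q' m"
       "\<forall>x\<in>carrier (E (Suc n)). q' 0 x = x" "\<forall>m. \<forall>x\<in>carrier (E n). \<delta> n (q m x) = q' m (\<delta> n x)"
      using cartan_lift[OF inf E delta(1) E_ab module.smult_closed[OF D(1)] D(3) q1 q2 q3] by blast
    have "q' m x \<in> \<delta> n ` carrier (E n)" if x: "x \<in> \<delta> n ` carrier (E n)" for m x
    proof -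
      obtain y where "y \<in> carrier (E n)" "x = \<delta> n y" using x by blast
      moreover have "q m y \<in> carrier (E n)" using cartan_opD(1)[OF q1] calculation by blast
      ultimately show ?thesis using q'(3) by (metis imageI)
    qed
    with q' have "I (Suc n) q'" unfolding I_def delta(2)[symmetric] by blast
    then show "\<exists>q'. I (Suc n) q' \<and> (\<forall>m. \<forall>x\<in>carrier (E n). \<delta> n (q m x) = q' m (\<delta> n x))"
      using q' by blast
  qed
  then show ?thesis unfolding I_def by blast
qed

end

section \<open>Quotients and cohomology\<close>

context
  fixes S :: "('s, 'x) ring_scheme" and Z :: "('s, 'm) module" and B
  assumes Z: "module S Z" and B: "submodule B S Z"
begin

interpretation Z: module S Z by (rule Z)
interpretation B: submodule B S Z by (rule B)
interpretation BZ: abelian_subgroup B Z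
  by (intro abelian_subgroupI3 additive_subgroup.intro B.subgroup_axioms Z.abelian_group_axioms)

lemma quotient_carrier: "carrier (quotient_module Z B) = (\<lambda>x. B +>\<^bsub>Z\<^esub> x) ` carrier Z"
  by (auto simp: quotient_module_def A_RCOSETS_def')

lemma quotient_add:
  "x \<in> carrier Z \<Longrightarrow> y \<in> carrier Z \<Longrightarrow>
    (B +>\<^bsub>Z\<^esub> x) \<oplus>\<^bsub>quotient_module Z B\<^esub> (B +>\<^bsub>Z\<^esub> y) = B +>\<^bsub>Z\<^esub> (x \<oplus>\<^bsub>Z\<^esub> y)"
  by (simp add: quotient_module_def BZ.a_rcos_sum)

lemma quotient_zero: "\<zero>\<^bsub>quotient_module Z B\<^esub> = B +>\<^bsub>Z\<^esub> \<zero>\<^bsub>Z\<^esub>"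
  using Z.a_coset_add_zero BZ.a_subset by (simp add: quotient_module_def)

lemma coset_eq_iff:
  assumes "x \<in> carrier Z" "y \<in> carrier Z"
  shows "B +>\<^bsub>Z\<^esub> x = B +>\<^bsub>Z\<^esub> y \<longleftrightarrow> x \<oplus>\<^bsub>Z\<^esub> \<ominus>\<^bsub>Z\<^esub> y \<in> B"
proof -
  have "B +>\<^bsub>Z\<^esub> x = B +>\<^bsub>Z\<^esub> y \<longleftrightarrow> x \<in> B +>\<^bsub>Z\<^esub> y"
    using BZ.a_repr_independence'[of x y] BZ.a_rcos_self[of x] assms by auto
  then show ?thesis using BZ.a_rcos_module[OF assms(2,1)] by simp
qed

lemma quotient_smult:
  assumes "s \<in> carrier S" "x \<in> carrier Z"
  shows "s \<odot>\<^bsub>quotient_module Z B\<^esub> (B +>\<^bsub>Z\<^esub> x) = B +>\<^bsub>Z\<^esub> (s \<odot>\<^bsub>Z\<^esub> x)"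
proof -
  have "B +>\<^bsub>Z\<^esub> (s \<odot>\<^bsub>Z\<^esub> y) = B +>\<^bsub>Z\<^esub> (s \<odot>\<^bsub>Z\<^esub> x)" if "y \<in> B +>\<^bsub>Z\<^esub> x" for y
  proof -
    have y: "y \<in> carrier Z" using that assms BZ.a_elemrcos_carrier by blast
    then have "y \<oplus>\<^bsub>Z\<^esub> \<ominus>\<^bsub>Z\<^esub> x \<in> B" using that BZ.a_rcos_module assms by simp
    then have "s \<odot>\<^bsub>Z\<^esub> (y \<oplus>\<^bsub>Z\<^esub> \<ominus>\<^bsub>Z\<^esub> x) \<in> B" using assms by simp
    then show ?thesis using y assms
      by (simp add: coset_eq_iff Z.smult_r_distr Z.smult_r_minus)
  qed
  then have "(\<Union>y\<in>B +>\<^bsub>Z\<^esub> x. B +>\<^bsub>Z\<^esub> (s \<odot>\<^bsub>Z\<^esub> y)) = (\<Union>y\<in>B +>\<^bsub>Z\<^esub> x. B +>\<^bsub>Z\<^esub> (s \<odot>\<^bsub>Z\<^esub> x))"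
    by simp
  also have "\<dots> = B +>\<^bsub>Z\<^esub> (s \<odot>\<^bsub>Z\<^esub> x)"
    using BZ.a_rcos_self[OF assms(2)] by (simp add: UN_constant) blast
  finally show ?thesis by (simp add: quotient_module_def)
qed

lemma quotient_is_module: "module S (quotient_module Z B)"
proof -
  let ?H = "quotient_module Z B"
  note [simp] = quotient_add quotient_smult
  have rep: "\<exists>x\<in>carrier Z. u = B +>\<^bsub>Z\<^esub> x" if "u \<in> carrier ?H" for u
    using that quotient_carrier by auto
  have cls: "B +>\<^bsub>Z\<^esub> x \<in> carrier ?H" if "x \<in> carrier Z" for x
    using that quotient_carrier by auto
  have "abelian_group ?H"
  proof (rule abelian_groupI)
    show "\<zero>\<^bsub>?H\<^esub> \<in> carrier ?H" unfolding quotient_zero by (rule cls) simp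
  next
    fix u assume "u \<in> carrier ?H"
    then obtain x where x: "x \<in> carrier Z" "u = B +>\<^bsub>Z\<^esub> x" using rep by blast
    then have "(B +>\<^bsub>Z\<^esub> (\<ominus>\<^bsub>Z\<^esub> x)) \<oplus>\<^bsub>?H\<^esub> u = \<zero>\<^bsub>?H\<^esub>"
      unfolding quotient_zero by (simp add: Z.l_neg)
    then show "\<exists>y\<in>carrier ?H. y \<oplus>\<^bsub>?H\<^esub> u = \<zero>\<^bsub>?H\<^esub>"
      using x cls[of "\<ominus>\<^bsub>Z\<^esub> x"] by blast
    show "\<zero>\<^bsub>?H\<^esub> \<oplus>\<^bsub>?H\<^esub> u = u"
      unfolding quotient_zero x(2) quotient_add[OF Z.zero_closed x(1)] using x(1) by simp
    fix v assume "v \<in> carrier ?H"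
    then obtain y where y: "y \<in> carrier Z" "v = B +>\<^bsub>Z\<^esub> y" using rep by blast
    show "u \<oplus>\<^bsub>?H\<^esub> v \<in> carrier ?H" using x y cls by simp
    show "u \<oplus>\<^bsub>?H\<^esub> v = v \<oplus>\<^bsub>?H\<^esub> u" using x y by (simp add: Z.a_comm)
    fix w assume "w \<in> carrier ?H"
    then obtain z where "z \<in> carrier Z" "w = B +>\<^bsub>Z\<^esub> z" using rep by blast
    then show "u \<oplus>\<^bsub>?H\<^esub> v \<oplus>\<^bsub>?H\<^esub> w = u \<oplus>\<^bsub>?H\<^esub> (v \<oplus>\<^bsub>?H\<^esub> w)"
      using x y by (simp add: Z.a_assoc)
  qed
  then show ?thesis
  proof (intro moduleI module.axioms(1)[OF Z])
    fix s u assume s: "s \<in> carrier S" and "u \<in> carrier ?H"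
    then obtain x where x: "x \<in> carrier Z" "u = B +>\<^bsub>Z\<^esub> x" using rep by blast
    show "s \<odot>\<^bsub>?H\<^esub> u \<in> carrier ?H" using s x cls by simp
    fix t assume t: "t \<in> carrier S"
    show "(s \<oplus>\<^bsub>S\<^esub> t) \<odot>\<^bsub>?H\<^esub> u = s \<odot>\<^bsub>?H\<^esub> u \<oplus>\<^bsub>?H\<^esub> t \<odot>\<^bsub>?H\<^esub> u"
      using s t x by (simp add: Z.smult_l_distr)
    show "(s \<otimes>\<^bsub>S\<^esub> t) \<odot>\<^bsub>?H\<^esub> u = s \<odot>\<^bsub>?H\<^esub> (t \<odot>\<^bsub>?H\<^esub> u)"
      using s t x by (simp add: Z.smult_assoc1)
  next
    fix s u v assume s: "s \<in> carrier S" and "u \<in> carrier ?H" "v \<in> carrier ?H"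
    then obtain x y where "x \<in> carrier Z" "u = B +>\<^bsub>Z\<^esub> x" "y \<in> carrier Z" "v = B +>\<^bsub>Z\<^esub> y"
      using rep by metis
    then show "s \<odot>\<^bsub>?H\<^esub> (u \<oplus>\<^bsub>?H\<^esub> v) = s \<odot>\<^bsub>?H\<^esub> u \<oplus>\<^bsub>?H\<^esub> s \<odot>\<^bsub>?H\<^esub> v"
      using s by (simp add: Z.smult_r_distr)
  next
    fix u assume "u \<in> carrier ?H"
    then obtain x where "x \<in> carrier Z" "u = B +>\<^bsub>Z\<^esub> x" using rep by blast
    then show "\<one>\<^bsub>S\<^esub> \<odot>\<^bsub>?H\<^esub> u = u" by simp
  qed
qed

end

context cartan_ring
begin

text \<open>A Cartan family on \<open>Z\<close> that maps \<open>B\<close> to itself acts on the cosets of \<open>B\<close>. The operators on the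
  quotient are additive and satisfy the Cartan formula because the projection is linear.\<close>

lemma cartan_quotient:
  fixes G :: "('g, 'y) monoid_scheme" and Z :: "('s, 'm) module"
  assumes Z: "module S Z" and B: "submodule B S Z"
    and q: "\<And>m. cartan_op G Z \<rho> (carrier Z) q m" "\<And>x. x \<in> carrier Z \<Longrightarrow> q 0 x = x"
    and q_B: "\<And>m x. x \<in> B \<Longrightarrow> q m x \<in> B"
  shows "\<exists>Q. (\<forall>m. \<forall>\<alpha>\<in>carrier (quotient_module Z B). Q m \<alpha> \<in> carrier (quotient_module Z B)) \<and>
    (\<forall>m. \<forall>\<alpha>\<in>carrier (quotient_module Z B). \<forall>\<beta>\<in>carrier (quotient_module Z B).
       Q m (\<alpha> \<oplus>\<^bsub>quotient_module Z B\<^esub> \<beta>) = Q m \<alpha> \<oplus>\<^bsub>quotient_module Z B\<^esub> Q m \<beta>) \<and>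
    (\<forall>\<alpha>\<in>carrier (quotient_module Z B). Q 0 \<alpha> = \<alpha>) \<and>
    (\<forall>m. \<forall>s\<in>carrier S. \<forall>\<alpha>\<in>carrier (quotient_module Z B).
       Q m (s \<odot>\<^bsub>quotient_module Z B\<^esub> \<alpha>) =
       (\<Oplus>\<^bsub>quotient_module Z B\<^esub>a\<in>{..m}. P a s \<odot>\<^bsub>quotient_module Z B\<^esub> Q (m - a) \<alpha>))"
proof -
  let ?H = "quotient_module Z B" and ?\<pi> = "\<lambda>x. B +>\<^bsub>Z\<^esub> x"
  interpret Z: module S Z by (rule Z)
  interpret H: module S ?H by (rule quotient_is_module[OF Z B])
  note [simp] = quotient_add[OF Z B] quotient_smult[OF Z B]
  note carrier_H = quotient_carrier[OF Z B]
  note q_closed = cartan_opD(1)[OF q(1)] and q_add = cartan_opD(2)[OF q(1)]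
  have well_defined: "?\<pi> (q m x) = ?\<pi> (q m y)" if "x \<in> carrier Z" "y \<in> carrier Z" "?\<pi> x = ?\<pi> y" for m x y
  proof -
    let ?d = "x \<oplus>\<^bsub>Z\<^esub> \<ominus>\<^bsub>Z\<^esub> y"
    have "?d \<in> B" using that coset_eq_iff[OF Z B] by simp
    then have d: "q m ?d \<in> B" by (rule q_B)
    have "q m x = q m ?d \<oplus>\<^bsub>Z\<^esub> q m y"
      using that q_add[of ?d y m] by (simp add: Z.a_assoc Z.l_neg)
    then have "q m x \<oplus>\<^bsub>Z\<^esub> \<ominus>\<^bsub>Z\<^esub> q m y = q m ?d"
      using that q_closed by (simp add: Z.a_assoc Z.r_neg)
    then show ?thesis using d that q_closed coset_eq_iff[OF Z B] by simp
  qed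
  define Q where "Q m \<alpha> = ?\<pi> (q m (SOME x. x \<in> carrier Z \<and> ?\<pi> x = \<alpha>))" for m \<alpha>
  have Q: "Q m (?\<pi> x) = ?\<pi> (q m x)" if "x \<in> carrier Z" for m x
  proof -
    have "(SOME y. y \<in> carrier Z \<and> ?\<pi> y = ?\<pi> x) \<in> carrier Z \<and> ?\<pi> (SOME y. y \<in> carrier Z \<and> ?\<pi> y = ?\<pi> x) = ?\<pi> x"
      by (rule someI_ex) (use that in blast)
    then show ?thesis unfolding Q_def using well_defined that by blast
  qed
  show ?thesis
  proof (intro exI[of _ Q] conjI allI ballI)
    fix m \<alpha> assume "\<alpha> \<in> carrier ?H"
    then obtain x where x: "x \<in> carrier Z" "\<alpha> = ?\<pi> x" unfolding carrier_H by blast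
    show "Q m \<alpha> \<in> carrier ?H" using x q_closed by (auto simp: Q carrier_H)
    { fix \<beta> assume "\<beta> \<in> carrier ?H"
      then obtain y where y: "y \<in> carrier Z" "\<beta> = ?\<pi> y" unfolding carrier_H by blast
      show "Q m (\<alpha> \<oplus>\<^bsub>?H\<^esub> \<beta>) = Q m \<alpha> \<oplus>\<^bsub>?H\<^esub> Q m \<beta>"
        using x y q_closed by (simp add: Q q_add) }
    { fix s assume s: "s \<in> carrier S"
      have "Q m (s \<odot>\<^bsub>?H\<^esub> \<alpha>) = ?\<pi> (\<Oplus>\<^bsub>Z\<^esub>a\<in>{..m}. P a s \<odot>\<^bsub>Z\<^esub> q (m - a) x)"
        using x s by (simp add: Q cartan_opD(4)[OF q(1)])
      also have "\<dots> = (\<Oplus>\<^bsub>?H\<^esub>a\<in>{..m}. ?\<pi> (P a s \<odot>\<^bsub>Z\<^esub> q (m - a) x))"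
        by (rule additive_finsum[OF Z.abelian_group_axioms H.abelian_group_axioms])
           (use q_closed x s carrier_H in auto)
      also have "\<dots> = (\<Oplus>\<^bsub>?H\<^esub>a\<in>{..m}. P a s \<odot>\<^bsub>?H\<^esub> Q (m - a) \<alpha>)"
        by (rule H.finsum_cong') (use q_closed x s in \<open>auto simp: Q carrier_H intro!: H.smult_closed\<close>)
      finally show "Q m (s \<odot>\<^bsub>?H\<^esub> \<alpha>) = (\<Oplus>\<^bsub>?H\<^esub>a\<in>{..m}. P a s \<odot>\<^bsub>?H\<^esub> Q (m - a) \<alpha>)" . }
  next
    fix \<alpha> assume "\<alpha> \<in> carrier ?H"
    then show "Q 0 \<alpha> = \<alpha>" using Q q(2) by (auto simp: carrier_H)
  qed
qed

end

context cartan_ring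
begin

text \<open>The lifted family is applied to \<open>Z\<close>, the fixed cocycles of degree \<open>i\<close>, and \<open>B\<close>, the images of
  fixed cochains. Equivariance preserves fixed points, and compatibility with the differentials
  preserves cocycles and coboundaries.\<close>

lemma cartan_cohomology:
  fixes G :: "('g, 'y) monoid_scheme" and E :: "nat \<Rightarrow> ('s, 'm) module" and M :: "('s, 'a) module" and i :: nat
  assumes inf: "infinite (UNIV :: 's set)" and res: "injective_resolution S G M \<rho> E \<tau> \<epsilon> \<delta>"
    and M: "abelian_group M" "\<And>s x. s \<in> carrier S \<Longrightarrow> x \<in> carrier M \<Longrightarrow> s \<odot>\<^bsub>M\<^esub> x \<in> carrier M"
      "\<And>g x. g \<in> carrier G \<Longrightarrow> x \<in> carrier M \<Longrightarrow> \<rho> g x \<in> carrier M"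
    and p: "\<And>m. cartan_op G M \<rho> (carrier M) p m" "\<And>x. x \<in> carrier M \<Longrightarrow> p 0 x = x"
  defines "H \<equiv> group_cohomology G E \<tau> \<delta> i"
  shows "module S H"
    and "\<exists>Q. (\<forall>m. \<forall>\<alpha>\<in>carrier H. Q m \<alpha> \<in> carrier H) \<and>
    (\<forall>m. \<forall>\<alpha>\<in>carrier H. \<forall>\<beta>\<in>carrier H. Q m (\<alpha> \<oplus>\<^bsub>H\<^esub> \<beta>) = Q m \<alpha> \<oplus>\<^bsub>H\<^esub> Q m \<beta>) \<and>
    (\<forall>\<alpha>\<in>carrier H. Q 0 \<alpha> = \<alpha>) \<and>
    (\<forall>m. \<forall>s\<in>carrier S. \<forall>\<alpha>\<in>carrier H.
       Q m (s \<odot>\<^bsub>H\<^esub> \<alpha>) = (\<Oplus>\<^bsub>H\<^esub>a\<in>{..m}. P a s \<odot>\<^bsub>H\<^esub> Q (m - a) \<alpha>))"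
proof -
  have "injective_module S G (E n) (\<tau> n)" for n
    using res by (simp add: injective_resolution_def)
  then have E: "group_ring_module S G (E n) (\<tau> n)" for n by (simp add: injective_module_def)
  note D = group_ring_moduleD[OF E]
  interpret E: module S "E n" for n by (rule D)
  have delta: "\<delta> n \<in> group_ring_hom S G (E n) (\<tau> n) (E (Suc n)) (\<tau> (Suc n))"
    and exact: "\<delta> n ` carrier (E n) = a_kernel (E (Suc n)) (E (Suc (Suc n))) (\<delta> (Suc n))" for n
    using res by (auto simp: injective_resolution_def)
  have d_closed: "\<delta> n x \<in> carrier (E (Suc n))" if "x \<in> carrier (E n)" for n x
    using delta[of n] that by (auto simp: group_ring_hom_def mod_hom_def)
  have d_add: "\<delta> n (x \<oplus>\<^bsub>E n\<^esub> y) = \<delta> n x \<oplus>\<^bsub>E (Suc n)\<^esub> \<delta> n y"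
    if "x \<in> carrier (E n)" "y \<in> carrier (E n)" for n x y
    using delta[of n] that by (auto simp: group_ring_hom_def mod_hom_def)
  have d_smult: "\<delta> n (s \<odot>\<^bsub>E n\<^esub> x) = s \<odot>\<^bsub>E (Suc n)\<^esub> \<delta> n x" if "s \<in> carrier S" "x \<in> carrier (E n)" for n s x
    using delta[of n] that by (auto simp: group_ring_hom_def mod_hom_def)
  have d_act: "\<delta> n (\<tau> n g x) = \<tau> (Suc n) g (\<delta> n x)" if "g \<in> carrier G" "x \<in> carrier (E n)" for n g x
    using delta[of n] that by (auto simp: group_ring_hom_def)
  have d_zero: "\<delta> n \<zero>\<^bsub>E n\<^esub> = \<zero>\<^bsub>E (Suc n)\<^esub>" for n
    by (rule additive_zero[OF E.abelian_group_axioms E.abelian_group_axioms]) (use d_closed d_add in auto)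
  have d_minus: "\<delta> n (\<ominus>\<^bsub>E n\<^esub> x) = \<ominus>\<^bsub>E (Suc n)\<^esub> \<delta> n x" if "x \<in> carrier (E n)" for n x
    using that d_closed d_zero d_add[of "\<ominus>\<^bsub>E n\<^esub> x" n x]
    by (intro E.minus_equality[symmetric]) (auto simp: E.l_neg)
  have t_zero: "\<tau> n g \<zero>\<^bsub>E n\<^esub> = \<zero>\<^bsub>E n\<^esub>" if "g \<in> carrier G" for n g
    by (rule additive_zero[OF E.abelian_group_axioms E.abelian_group_axioms]) (use that D in auto)
  have t_minus: "\<tau> n g (\<ominus>\<^bsub>E n\<^esub> x) = \<ominus>\<^bsub>E n\<^esub> \<tau> n g x" if "g \<in> carrier G" "x \<in> carrier (E n)" for n g x
    using that D(3) D(4)[OF that(1), of "\<ominus>\<^bsub>E n\<^esub> x" n x] t_zero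
    by (intro E.minus_equality[symmetric]) (auto simp: E.l_neg)
  obtain q where q: "\<And>n m. cartan_op G (E n) (\<tau> n) (carrier (E n)) (q n) m"
    and q0: "\<And>n x. x \<in> carrier (E n) \<Longrightarrow> q n 0 x = x"
    and qd: "\<And>n m x. x \<in> carrier (E n) \<Longrightarrow> \<delta> n (q n m x) = q (Suc n) m (\<delta> n x)"
    using cartan_resolution[OF inf res M p] by blast
  note q_closed = cartan_opD(1)[OF q] and q_add = cartan_opD(2)[OF q] and q_act = cartan_opD(3)[OF q]
  have q_zero: "q n m \<zero>\<^bsub>E n\<^esub> = \<zero>\<^bsub>E n\<^esub>" for n m
    by (rule additive_zero[OF E.abelian_group_axioms E.abelian_group_axioms]) (use q_closed q_add in auto)
  define F where "F n = {x \<in> carrier (E n). \<forall>g\<in>carrier G. \<tau> n g x = x}" for n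
  define K where "K = {x \<in> F i. \<delta> i x = \<zero>\<^bsub>E (Suc i)\<^esub>}"
  define B where "B = (case i of 0 \<Rightarrow> {\<zero>\<^bsub>E 0\<^esub>} | Suc n \<Rightarrow> \<delta> n ` F n)"
  define Z where "Z = (E i)\<lparr>carrier := K\<rparr>"
  have H: "H = quotient_module Z B"
    by (simp add: H_def group_cohomology_def cohomology_def fixed_points_def Z_def B_def K_def F_def
        a_kernel_def' split: nat.split)
  have F_submodule: "submodule (F n) S (E n)" for n
    by (rule E.submoduleI) (auto simp: F_def t_zero t_minus D)
  have K_submodule: "submodule K S (E i)"
  proof -
    interpret F: submodule "F i" S "E i" by (rule F_submodule)
    note FE = E.submoduleE[OF F_submodule]
    show ?thesis
      by (rule E.submoduleI)
         (use FE F.one_closed in \<open>auto simp: K_def F_def d_zero d_minus d_add d_smult\<close>)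
  qed
  have Z: "module S Z"
    unfolding Z_def by (rule submodule.submodule_is_module[OF K_submodule E.module_axioms])
  have B_sub: "B \<subseteq> K"
  proof (cases i)
    case 0
    then show ?thesis by (auto simp: B_def K_def F_def d_zero t_zero)
  next
    case (Suc n)
    have "\<delta> (Suc n) (\<delta> n x) = \<zero>\<^bsub>E (Suc (Suc n))\<^esub>" if "x \<in> carrier (E n)" for x
      using exact[of n] that by (auto simp: a_kernel_def')
    then show ?thesis
      using Suc by (auto simp: B_def K_def F_def d_closed simp flip: d_act)
  qed
  have B_submodule: "submodule B S (E i)"
  proof (cases i)
    case 0
    then show ?thesis
      by (intro E.submoduleI) (auto simp: B_def)
  next
    case (Suc n)
    interpret F: submodule "F n" S "E n" by (rule F_submodule)
    note FE = E.submoduleE[OF F_submodule]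
    have c: "x \<in> carrier (E n)" if "x \<in> F n" for x using that by (simp add: F_def)
    have "submodule (\<delta> n ` F n) S (E (Suc n))"
    proof (rule E.submoduleI)
      show "\<delta> n ` F n \<subseteq> carrier (E (Suc n))" using d_closed c by auto
      show "\<zero>\<^bsub>E (Suc n)\<^esub> \<in> \<delta> n ` F n" using d_zero F.one_closed by (metis imageI monoid.select_convs(2))
    next
      fix a assume "a \<in> \<delta> n ` F n" then show "\<ominus>\<^bsub>E (Suc n)\<^esub> a \<in> \<delta> n ` F n"
        using FE(3) by (auto simp: c simp flip: d_minus)
    next
      fix a b assume "a \<in> \<delta> n ` F n" "b \<in> \<delta> n ` F n" then show "a \<oplus>\<^bsub>E (Suc n)\<^esub> b \<in> \<delta> n ` F n"
        using FE(5) by (auto simp: c simp flip: d_add)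
    next
      fix s a assume "s \<in> carrier S" "a \<in> \<delta> n ` F n" then show "s \<odot>\<^bsub>E (Suc n)\<^esub> a \<in> \<delta> n ` F n"
        using FE(4) by (auto simp: c simp flip: d_smult)
    qed
    then show ?thesis using Suc by (simp add: B_def)
  qed
  have ZB: "submodule B S Z"
    using submodule.submodule_is_module[OF B_submodule E.module_axioms] B_sub
    by (intro module.module_incl_imp_submodule[OF Z]) (simp_all add: Z_def)
  show mod: "module S H" unfolding H by (rule quotient_is_module[OF Z ZB])
  have qF: "q n m x \<in> F n" if "x \<in> F n" for n m x
    using that q_closed by (auto simp: F_def simp flip: q_act)
  have qK: "q i m x \<in> K" if "x \<in> K" for m x
    using that qF qd[of x i m] q_zero by (auto simp: K_def F_def)
  have qB: "q i m x \<in> B" if x: "x \<in> B" for m x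
  proof (cases i)
    case 0
    then show ?thesis using x q_zero by (auto simp: B_def)
  next
    case (Suc n)
    obtain y where y: "y \<in> F n" "x = \<delta> n y" using x Suc by (auto simp: B_def)
    have "q i m x = \<delta> n (q n m y)"
      using qd[of y n m] y unfolding Suc F_def by simp
    then show ?thesis using Suc qF[OF y(1)] by (simp add: B_def)
  qed
  have qZ: "cartan_op G Z (\<tau> i) (carrier Z) (q i) m" for m
  proof -
    have K_E: "K \<subseteq> carrier (E i)" by (auto simp: K_def F_def)
    have "cartan_op G (E i) (\<tau> i) K (q i) m" by (rule cartan_op_subset[OF q K_E])
    moreover have "(\<Oplus>\<^bsub>Z\<^esub>a\<in>{..m}. P a s \<odot>\<^bsub>E i\<^esub> q i (m - a) x)
        = (\<Oplus>\<^bsub>E i\<^esub>a\<in>{..m}. P a s \<odot>\<^bsub>E i\<^esub> q i (m - a) x)" if "s \<in> carrier S" "x \<in> K" for s x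
      unfolding Z_def
    proof (rule finsum_restrict_carrier)
      show "abelian_monoid ((E i)\<lparr>carrier := K\<rparr>)"
        using module.axioms(2)[OF Z] by (simp add: Z_def abelian_group_def)
      show "(\<lambda>a. P a s \<odot>\<^bsub>E i\<^esub> q i (m - a) x) \<in> {..m} \<rightarrow> K"
        using that qK E.submoduleE(4)[OF K_submodule] by auto
    qed (rule E.abelian_monoid_axioms, rule K_E)
    ultimately show ?thesis using qK unfolding cartan_op_def by (simp add: Z_def)
  qed
  have "q i 0 x = x" if "x \<in> carrier Z" for x
    using q0 that by (simp add: Z_def K_def F_def)
  from cartan_quotient[OF Z ZB qZ this qB]
  show "\<exists>Q. (\<forall>m. \<forall>\<alpha>\<in>carrier H. Q m \<alpha> \<in> carrier H) \<and>
    (\<forall>m. \<forall>\<alpha>\<in>carrier H. \<forall>\<beta>\<in>carrier H. Q m (\<alpha> \<oplus>\<^bsub>H\<^esub> \<beta>) = Q m \<alpha> \<oplus>\<^bsub>H\<^esub> Q m \<beta>) \<and>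
    (\<forall>\<alpha>\<in>carrier H. Q 0 \<alpha> = \<alpha>) \<and>
    (\<forall>m. \<forall>s\<in>carrier S. \<forall>\<alpha>\<in>carrier H.
       Q m (s \<odot>\<^bsub>H\<^esub> \<alpha>) = (\<Oplus>\<^bsub>H\<^esub>a\<in>{..m}. P a s \<odot>\<^bsub>H\<^esub> Q (m - a) \<alpha>))"
    unfolding H .
qed

end

section \<open>The symmetric algebra\<close>

lemma poly_mapping_induct_on [consumes 1, case_names zero single add]:
  fixes p :: "'x \<Rightarrow>\<^sub>0 'b::comm_monoid_add"
  assumes "Poly_Mapping.keys p \<subseteq> C" and "Q 0"
    and "\<And>m a. m \<in> C \<Longrightarrow> Q (Poly_Mapping.single m a)"
    and "\<And>p q. Poly_Mapping.keys p \<subseteq> C \<Longrightarrow> Poly_Mapping.keys q \<subseteq> C \<Longrightarrow> Q p \<Longrightarrow> Q q \<Longrightarrow> Q (p + q)"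
  shows "Q p"
proof -
  let ?sum = "\<lambda>F. \<Sum>m\<in>F. Poly_Mapping.single m (poly_mapping.lookup p m)"
  have "Poly_Mapping.keys (?sum F) \<subseteq> C \<and> Q (?sum F)" if "finite F" "F \<subseteq> C" for F
    using that
  proof (induction F rule: finite_induct)
    case (insert m F)
    let ?t = "Poly_Mapping.single m (poly_mapping.lookup p m)"
    have t: "Poly_Mapping.keys ?t \<subseteq> C" "Q ?t" using insert assms(3) by auto
    have IH: "Poly_Mapping.keys (?sum F) \<subseteq> C" "Q (?sum F)" using insert by auto
    have "?sum (insert m F) = ?t + ?sum F" using insert by simp
    then show ?case using assms(4)[OF t(1) IH(1) t(2) IH(2)] Poly_Mapping.keys_add[of ?t "?sum F"] t(1) IH(1)
      by auto
  qed (simp add: assms(2))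
  moreover have "?sum (Poly_Mapping.keys p) = p"
    by (rule poly_mapping_eqI)
       (auto simp: lookup_sum lookup_single when_def in_keys_iff)
  ultimately show ?thesis using assms(1) by (metis finite_keys)
qed

lemma keys_mult_subset:
  fixes p q :: "('x \<Rightarrow>\<^sub>0 nat) \<Rightarrow>\<^sub>0 'k::semiring_0"
  assumes "Poly_Mapping.keys p \<subseteq> {m. Poly_Mapping.keys m \<subseteq> D}"
    and "Poly_Mapping.keys q \<subseteq> {m. Poly_Mapping.keys m \<subseteq> D}"
  shows "Poly_Mapping.keys (p * q) \<subseteq> {m. Poly_Mapping.keys m \<subseteq> D}"
proof
  fix m assume "m \<in> Poly_Mapping.keys (p * q)"
  then obtain a b where ab: "m = a + b" "a \<in> Poly_Mapping.keys p" "b \<in> Poly_Mapping.keys q"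
    using keys_mult[of p q] by auto
  then have "Poly_Mapping.keys a \<subseteq> D" "Poly_Mapping.keys b \<subseteq> D" using assms by auto
  then show "m \<in> {m. Poly_Mapping.keys m \<subseteq> D}" using Poly_Mapping.keys_add[of a b] ab(1) by auto
qed

definition eval_monomial :: "('t, 'y) ring_scheme \<Rightarrow> ('x \<Rightarrow> 't) \<Rightarrow> ('x \<Rightarrow>\<^sub>0 nat) \<Rightarrow> 't" where
  "eval_monomial T h m = (\<Otimes>\<^bsub>T\<^esub>v\<in>Poly_Mapping.keys m. h v [^]\<^bsub>T\<^esub> poly_mapping.lookup m v)"

definition eval_poly :: "('t, 'y) ring_scheme \<Rightarrow> ('k::zero \<Rightarrow> 't) \<Rightarrow> ('x \<Rightarrow> 't) \<Rightarrow> (('x \<Rightarrow>\<^sub>0 nat) \<Rightarrow>\<^sub>0 'k) \<Rightarrow> 't" where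
  "eval_poly T c h p = (\<Oplus>\<^bsub>T\<^esub>m\<in>Poly_Mapping.keys p. c (poly_mapping.lookup p m) \<otimes>\<^bsub>T\<^esub> eval_monomial T h m)"

context
  fixes T :: "('t, 'y) ring_scheme" and c :: "'k::field \<Rightarrow> 't" and h :: "'x \<Rightarrow> 't" and D :: "'x set"
  assumes T: "cring T" and h: "\<And>v. v \<in> D \<Longrightarrow> h v \<in> carrier T"
    and c_closed: "\<And>a. c a \<in> carrier T" and c_add: "\<And>a b. c (a + b) = c a \<oplus>\<^bsub>T\<^esub> c b"
    and c_mult: "\<And>a b. c (a * b) = c a \<otimes>\<^bsub>T\<^esub> c b" and c_one: "c 1 = \<one>\<^bsub>T\<^esub>"
begin

interpretation T: cring T by (rule T)

abbreviation "supported \<equiv> {m :: 'x \<Rightarrow>\<^sub>0 nat. Poly_Mapping.keys m \<subseteq> D}"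

lemma coefficient_map_zero: "c 0 = \<zero>\<^bsub>T\<^esub>"
  using c_add[of 0 0] c_closed[of 0] by (metis add_0 T.add.r_cancel_one' )

lemma eval_monomial_superset:
  assumes "finite F" "Poly_Mapping.keys m \<subseteq> F" "F \<subseteq> D"
  shows "eval_monomial T h m = (\<Otimes>\<^bsub>T\<^esub>v\<in>F. h v [^]\<^bsub>T\<^esub> poly_mapping.lookup m v)"
  unfolding eval_monomial_def using assms h
  by (intro T.finprod_mono_neutral_cong_left) (auto simp: in_keys_iff)

lemma eval_monomial_closed: "m \<in> supported \<Longrightarrow> eval_monomial T h m \<in> carrier T"
  unfolding eval_monomial_def using h by (intro T.finprod_closed) auto

lemma eval_monomial_add:
  assumes "m \<in> supported" "n \<in> supported"
  shows "eval_monomial T h (m + n) = eval_monomial T h m \<otimes>\<^bsub>T\<^esub> eval_monomial T h n"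
proof -
  let ?F = "Poly_Mapping.keys m \<union> Poly_Mapping.keys n"
  have F: "finite ?F" "?F \<subseteq> D" using assms by auto
  have "eval_monomial T h (m + n) = (\<Otimes>\<^bsub>T\<^esub>v\<in>?F. h v [^]\<^bsub>T\<^esub> poly_mapping.lookup (m + n) v)"
    by (rule eval_monomial_superset[OF F(1) Poly_Mapping.keys_add F(2)])
  also have "\<dots> = (\<Otimes>\<^bsub>T\<^esub>v\<in>?F. h v [^]\<^bsub>T\<^esub> poly_mapping.lookup m v \<otimes>\<^bsub>T\<^esub> h v [^]\<^bsub>T\<^esub> poly_mapping.lookup n v)"
    by (rule T.finprod_cong') (use F h in \<open>auto simp: lookup_add T.nat_pow_mult\<close>)
  also have "\<dots> = (\<Otimes>\<^bsub>T\<^esub>v\<in>?F. h v [^]\<^bsub>T\<^esub> poly_mapping.lookup m v) \<otimes>\<^bsub>T\<^esub> (\<Otimes>\<^bsub>T\<^esub>v\<in>?F. h v [^]\<^bsub>T\<^esub> poly_mapping.lookup n v)"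
    by (rule T.finprod_multf) (use F h in auto)
  finally show ?thesis using F by (simp add: eval_monomial_superset[of ?F])
qed

lemma eval_monomial_single: "v \<in> D \<Longrightarrow> eval_monomial T h (Poly_Mapping.single v 1) = h v"
  using h by (simp add: eval_monomial_def)

lemma eval_monomial_zero: "eval_monomial T h 0 = \<one>\<^bsub>T\<^esub>"
  by (simp add: eval_monomial_def)

lemma eval_poly_superset:
  assumes "finite F" "Poly_Mapping.keys p \<subseteq> F" "F \<subseteq> supported"
  shows "eval_poly T c h p = (\<Oplus>\<^bsub>T\<^esub>m\<in>F. c (poly_mapping.lookup p m) \<otimes>\<^bsub>T\<^esub> eval_monomial T h m)"
  unfolding eval_poly_def using assms eval_monomial_closed c_closed
  by (intro T.add.finprod_mono_neutral_cong_left) (auto simp: in_keys_iff coefficient_map_zero subset_iff)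

lemma eval_poly_closed: "Poly_Mapping.keys p \<subseteq> supported \<Longrightarrow> eval_poly T c h p \<in> carrier T"
  unfolding eval_poly_def using eval_monomial_closed c_closed by (intro T.finsum_closed) auto

lemma eval_poly_add:
  assumes "Poly_Mapping.keys p \<subseteq> supported" "Poly_Mapping.keys q \<subseteq> supported"
  shows "eval_poly T c h (p + q) = eval_poly T c h p \<oplus>\<^bsub>T\<^esub> eval_poly T c h q"
proof -
  let ?F = "Poly_Mapping.keys p \<union> Poly_Mapping.keys q"
  have F: "finite ?F" "?F \<subseteq> supported" using assms by auto
  have cl: "eval_monomial T h m \<in> carrier T" if "m \<in> ?F" for m
    using F(2) that eval_monomial_closed by blast
  have "eval_poly T c h (p + q) = (\<Oplus>\<^bsub>T\<^esub>m\<in>?F. c (poly_mapping.lookup (p + q) m) \<otimes>\<^bsub>T\<^esub> eval_monomial T h m)"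
    by (rule eval_poly_superset[OF F(1) Poly_Mapping.keys_add F(2)])
  also have "\<dots> = (\<Oplus>\<^bsub>T\<^esub>m\<in>?F. c (poly_mapping.lookup p m) \<otimes>\<^bsub>T\<^esub> eval_monomial T h m
      \<oplus>\<^bsub>T\<^esub> c (poly_mapping.lookup q m) \<otimes>\<^bsub>T\<^esub> eval_monomial T h m)"
    by (rule T.finsum_cong') (use cl c_closed in \<open>auto simp: lookup_add c_add T.l_distr\<close>)
  also have "\<dots> = (\<Oplus>\<^bsub>T\<^esub>m\<in>?F. c (poly_mapping.lookup p m) \<otimes>\<^bsub>T\<^esub> eval_monomial T h m)
      \<oplus>\<^bsub>T\<^esub> (\<Oplus>\<^bsub>T\<^esub>m\<in>?F. c (poly_mapping.lookup q m) \<otimes>\<^bsub>T\<^esub> eval_monomial T h m)"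
    by (rule T.finsum_addf) (use cl c_closed in auto)
  finally show ?thesis using F by (simp add: eval_poly_superset[of ?F])
qed

lemma eval_poly_single:
  assumes "m \<in> supported"
  shows "eval_poly T c h (Poly_Mapping.single m a) = c a \<otimes>\<^bsub>T\<^esub> eval_monomial T h m"
  using assms eval_monomial_closed[OF assms] c_closed
  by (subst eval_poly_superset[of "{m}"]) auto

text \<open>Both sides are additive in \<open>p\<close> and in \<open>q\<close>, so it suffices to compare them on terms.\<close>

lemma eval_poly_mult:
  assumes "Poly_Mapping.keys p \<subseteq> supported" "Poly_Mapping.keys q \<subseteq> supported"
  shows "eval_poly T c h (p * q) = eval_poly T c h p \<otimes>\<^bsub>T\<^esub> eval_poly T c h q"
  using assms(1)
proof (induction p rule: poly_mapping_induct_on)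
  case zero
  show ?case using eval_poly_closed[OF assms(2)] by (simp add: eval_poly_def)
next
  case (add p p')
  then show ?case
    using assms(2) eval_poly_closed keys_mult_subset[OF add(1) assms(2)] keys_mult_subset[OF add(2) assms(2)]
    by (simp add: distrib_right eval_poly_add T.l_distr)
next
  case (single m a)
  from assms(2) show ?case
  proof (induction q rule: poly_mapping_induct_on)
    case zero
    show ?case using single eval_monomial_closed c_closed
      by (subst (2) eval_poly_def) (simp add: eval_poly_single, simp add: eval_poly_def)
  next
    case (add q q')
    have s: "Poly_Mapping.keys (Poly_Mapping.single m a) \<subseteq> supported" using single by simp
    show ?case
      using add s eval_poly_closed keys_mult_subset[OF s add(1)] keys_mult_subset[OF s add(2)]
      by (simp add: distrib_left eval_poly_add T.r_distr)
  next
    case (single n b)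
    have "m + n \<in> supported"
      using single \<open>m \<in> supported\<close> Poly_Mapping.keys_add[of m n] by auto
    then show ?case
      using single \<open>m \<in> supported\<close> eval_monomial_closed c_closed
      by (simp add: mult_single eval_poly_single eval_monomial_add c_mult T.m_ac)
  qed
qed

lemma eval_poly_const: "eval_poly T c h (Poly_Mapping.single 0 a) = c a"
  using c_closed by (simp add: eval_poly_single eval_monomial_zero)

lemma eval_poly_var: "v \<in> D \<Longrightarrow> eval_poly T c h (Poly_Mapping.single (Poly_Mapping.single v 1) 1) = h v"
  using h by (simp add: eval_poly_single eval_monomial_single[simplified] c_one)

lemma eval_poly_one: "eval_poly T c h 1 = \<one>\<^bsub>T\<^esub>"
  using eval_poly_const[of 1] by (simp add: c_one)

end

lemma free_alg_sel [simp]: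
  "x \<oplus>\<^bsub>free_alg scale\<^esub> y = x + y" "x \<otimes>\<^bsub>free_alg scale\<^esub> y = x * y"
  "\<zero>\<^bsub>free_alg scale\<^esub> = 0" "\<one>\<^bsub>free_alg scale\<^esub> = 1"
  by (simp_all add: free_alg_def ring_of_type_algebra_def)

lemma free_alg_carrier:
  "p \<in> carrier (free_alg scale) \<longleftrightarrow> Poly_Mapping.keys p \<subseteq> {m. Poly_Mapping.keys m \<subseteq> dual scale}"
  by (auto simp: free_alg_def ring_of_type_algebra_def)

lemma free_alg_closed:
  assumes "p \<in> carrier (free_alg scale)" "q \<in> carrier (free_alg scale)"
  shows "p + q \<in> carrier (free_alg scale)" "p * q \<in> carrier (free_alg scale)"
proof -
  show "p + q \<in> carrier (free_alg scale)"
    using assms Poly_Mapping.keys_add[of p q] by (auto simp: free_alg_carrier)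
  show "p * q \<in> carrier (free_alg scale)"
    using assms unfolding free_alg_carrier by (rule keys_mult_subset)
qed

lemma free_alg_uminus: "p \<in> carrier (free_alg scale) \<Longrightarrow> - p \<in> carrier (free_alg scale)"
  by (auto simp: free_alg_carrier in_keys_iff)

lemma pconst_carrier: "pconst a \<in> carrier (free_alg scale)"
  by (auto simp: pconst_def free_alg_carrier)

lemma pvar_carrier: "\<phi> \<in> dual scale \<Longrightarrow> pvar \<phi> \<in> carrier (free_alg scale)"
  by (auto simp: pvar_def free_alg_carrier)

lemma free_alg_cring: "cring (free_alg scale)"
proof (rule cringI)
  show "abelian_group (free_alg scale)"
  proof (rule abelian_groupI)
    fix p assume "p \<in> carrier (free_alg scale)"
    then show "\<exists>q\<in>carrier (free_alg scale). q \<oplus>\<^bsub>free_alg scale\<^esub> p = \<zero>\<^bsub>free_alg scale\<^esub>"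
      using free_alg_uminus by (intro bexI[of _ "- p"]) auto
  qed (auto simp: free_alg_closed algebra_simps, simp add: free_alg_carrier)
  show "Group.comm_monoid (free_alg scale)"
    by (rule comm_monoidI) (auto simp: free_alg_closed algebra_simps, auto simp: free_alg_carrier)
qed (simp add: algebra_simps)

lemma free_alg_pow: "p [^]\<^bsub>free_alg scale\<^esub> n = p ^ n"
  by (induction n) (simp_all add: nat_pow_def algebra_simps)

lemma dual_add: "\<phi> \<in> dual scale \<Longrightarrow> \<psi> \<in> dual scale \<Longrightarrow> (\<lambda>v. \<phi> v + \<psi> v) \<in> dual scale"
  by (auto simp: dual_def Vector_Spaces.linear_iff algebra_simps)

lemma dual_scale: "\<phi> \<in> dual scale \<Longrightarrow> (\<lambda>v. a * \<phi> v) \<in> dual scale"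
  by (auto simp: dual_def Vector_Spaces.linear_iff algebra_simps)

definition sym_relations :: "('k::field \<Rightarrow> 'v::ab_group_add \<Rightarrow> 'v) \<Rightarrow> ('k, 'v) dual_poly set" where
  "sym_relations scale =
     {pvar (\<lambda>v. \<phi> v + \<psi> v) - pvar \<phi> - pvar \<psi> | \<phi> \<psi>. \<phi> \<in> dual scale \<and> \<psi> \<in> dual scale} \<union>
     {pvar (\<lambda>v. a * \<phi> v) - pconst a * pvar \<phi> | a \<phi>. \<phi> \<in> dual scale}"

lemma sym_ideal_eq: "sym_ideal scale = Idl\<^bsub>free_alg scale\<^esub> (sym_relations scale)"
  by (simp add: sym_ideal_def sym_relations_def)

lemma free_alg_diff:
  assumes "p \<in> carrier (free_alg scale)" "q \<in> carrier (free_alg scale)"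
  shows "p - q \<in> carrier (free_alg scale)"
  using free_alg_closed(1)[OF assms(1) free_alg_uminus[OF assms(2)]] by simp

lemma sym_relations_carrier: "sym_relations scale \<subseteq> carrier (free_alg scale)"
  unfolding sym_relations_def
  by (auto intro!: free_alg_diff free_alg_closed(2) pvar_carrier pconst_carrier dual_add dual_scale)

lemma sym_ideal_ideal: "ideal (sym_ideal scale) (free_alg scale)"
  unfolding sym_ideal_eq
  by (rule ring.genideal_ideal[OF cring.axioms(1)[OF free_alg_cring] sym_relations_carrier])

lemma sym_relations_ideal: "sym_relations scale \<subseteq> sym_ideal scale"
  unfolding sym_ideal_eq
  by (rule ring.genideal_self[OF cring.axioms(1)[OF free_alg_cring] sym_relations_carrier])

lemma Sym_cring: "cring (Sym scale)"
  unfolding Sym_def by (rule ideal.quotient_is_cring[OF sym_ideal_ideal free_alg_cring])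

definition sym_class :: "('k::field \<Rightarrow> 'v::ab_group_add \<Rightarrow> 'v) \<Rightarrow> ('k, 'v) dual_poly \<Rightarrow> ('k, 'v) sym" where
  "sym_class scale p = sym_ideal scale +>\<^bsub>free_alg scale\<^esub> p"

lemma sym_class_hom: "sym_class scale \<in> ring_hom (free_alg scale) (Sym scale)"
  using ideal.rcos_ring_hom[OF sym_ideal_ideal] by (simp add: Sym_def sym_class_def[abs_def])

lemma Sym_carrier: "carrier (Sym scale) = sym_class scale ` carrier (free_alg scale)"
  by (auto simp: Sym_def FactRing_def A_RCOSETS_def' sym_class_def)

lemma sym_class_simps:
  assumes "p \<in> carrier (free_alg scale)" "q \<in> carrier (free_alg scale)"
  shows "sym_class scale (p + q) = sym_class scale p \<oplus>\<^bsub>Sym scale\<^esub> sym_class scale q"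
    "sym_class scale (p * q) = sym_class scale p \<otimes>\<^bsub>Sym scale\<^esub> sym_class scale q"
  using ring_hom_memE(2,3)[OF sym_class_hom assms] by simp_all

lemma sym_class_closed: "p \<in> carrier (free_alg scale) \<Longrightarrow> sym_class scale p \<in> carrier (Sym scale)"
  by (rule ring_hom_memE(1)[OF sym_class_hom])

lemma sym_class_one: "sym_class scale 1 = \<one>\<^bsub>Sym scale\<^esub>"
  using ring_hom_memE(4)[OF sym_class_hom[of scale]] by simp

lemma sym_class_eqI:
  assumes "p \<in> carrier (free_alg scale)" "q \<in> carrier (free_alg scale)" "p - q \<in> sym_ideal scale"
  shows "sym_class scale p = sym_class scale q"
proof -
  interpret I: ideal "sym_ideal scale" "free_alg scale" by (rule sym_ideal_ideal)
  have "p = (p - q) \<oplus>\<^bsub>free_alg scale\<^esub> q" by simp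
  then have "p \<in> sym_ideal scale +>\<^bsub>free_alg scale\<^esub> q"
    using assms(3) unfolding a_r_coset_def' by blast
  then show ?thesis unfolding sym_class_def using I.a_repr_independence'[OF _ assms(2)] by simp
qed

lemma sym_const_eq: "sym_const scale a = sym_class scale (pconst a)"
  by (simp add: sym_const_def sym_class_def)

lemma sym_of_dual_eq: "sym_of_dual scale \<phi> = sym_class scale (pvar \<phi>)"
  by (simp add: sym_of_dual_def sym_class_def)

lemma sym_const_carrier [simp]: "sym_const scale a \<in> carrier (Sym scale)"
  by (simp add: sym_const_eq sym_class_closed pconst_carrier)

lemma sym_of_dual_carrier [simp]: "\<phi> \<in> dual scale \<Longrightarrow> sym_of_dual scale \<phi> \<in> carrier (Sym scale)"
  by (simp add: sym_of_dual_eq sym_class_closed pvar_carrier)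

lemma sym_const_add: "sym_const scale (a + b) = sym_const scale a \<oplus>\<^bsub>Sym scale\<^esub> sym_const scale b"
  unfolding sym_const_eq sym_class_simps(1)[OF pconst_carrier pconst_carrier, symmetric]
  by (simp add: pconst_def single_add)

lemma sym_const_mult: "sym_const scale (a * b) = sym_const scale a \<otimes>\<^bsub>Sym scale\<^esub> sym_const scale b"
  unfolding sym_const_eq sym_class_simps(2)[OF pconst_carrier pconst_carrier, symmetric]
  by (simp add: pconst_def mult_single)

lemma sym_const_one: "sym_const scale 1 = \<one>\<^bsub>Sym scale\<^esub>"
  unfolding sym_const_eq by (simp add: pconst_def sym_class_one)

lemma sym_of_dual_add:
  assumes "\<phi> \<in> dual scale" "\<psi> \<in> dual scale"
  shows "sym_of_dual scale (\<lambda>v. \<phi> v + \<psi> v) = sym_of_dual scale \<phi> \<oplus>\<^bsub>Sym scale\<^esub> sym_of_dual scale \<psi>"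
  unfolding sym_of_dual_eq
    sym_class_simps(1)[OF pvar_carrier[OF assms(1)] pvar_carrier[OF assms(2)], symmetric]
proof (rule sym_class_eqI)
  have "pvar (\<lambda>v. \<phi> v + \<psi> v) - pvar \<phi> - pvar \<psi> \<in> sym_ideal scale"
    using sym_relations_ideal assms by (fastforce simp: sym_relations_def)
  then show "pvar (\<lambda>v. \<phi> v + \<psi> v) - (pvar \<phi> + pvar \<psi>) \<in> sym_ideal scale"
    by (simp add: diff_diff_add)
qed (use assms in \<open>auto simp: pvar_carrier dual_add free_alg_closed\<close>)

lemma sym_of_dual_scale:
  assumes "\<phi> \<in> dual scale"
  shows "sym_of_dual scale (\<lambda>v. a * \<phi> v) = sym_const scale a \<otimes>\<^bsub>Sym scale\<^esub> sym_of_dual scale \<phi>"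
  unfolding sym_of_dual_eq sym_const_eq
    sym_class_simps(2)[OF pconst_carrier pvar_carrier[OF assms(1)], symmetric]
proof (rule sym_class_eqI)
  show "pvar (\<lambda>v. a * \<phi> v) - pconst a * pvar \<phi> \<in> sym_ideal scale"
    using sym_relations_ideal assms by (fastforce simp: sym_relations_def)
qed (use assms in \<open>auto simp: pvar_carrier pconst_carrier dual_scale free_alg_closed\<close>)

text \<open>\<open>Sym(V\<^sup>*)\<close> is generated as a ring by the scalars and \<open>V\<^sup>*\<close>.\<close>

lemma Sym_induct [consumes 1, case_names const dual add mult]:
  fixes scale :: "'k::field \<Rightarrow> 'v::ab_group_add \<Rightarrow> 'v"
  assumes f: "f \<in> carrier (Sym scale)"
    and const: "\<And>a. Q (sym_const scale a)"
    and dual: "\<And>\<phi>. \<phi> \<in> dual scale \<Longrightarrow> Q (sym_of_dual scale \<phi>)"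
    and add: "\<And>f g. f \<in> carrier (Sym scale) \<Longrightarrow> g \<in> carrier (Sym scale) \<Longrightarrow> Q f \<Longrightarrow> Q g \<Longrightarrow> Q (f \<oplus>\<^bsub>Sym scale\<^esub> g)"
    and mult: "\<And>f g. f \<in> carrier (Sym scale) \<Longrightarrow> g \<in> carrier (Sym scale) \<Longrightarrow> Q f \<Longrightarrow> Q g \<Longrightarrow> Q (f \<otimes>\<^bsub>Sym scale\<^esub> g)"
  shows "Q f"
proof -
  let ?\<pi> = "sym_class scale" and ?A = "free_alg scale"
  have single_carrier: "Poly_Mapping.single m a \<in> carrier ?A" if "Poly_Mapping.keys m \<subseteq> dual scale" for m and a :: 'k
    using that by (auto simp: free_alg_carrier)
  have mon: "\<forall>a. Q (?\<pi> (Poly_Mapping.single m a))" if "Poly_Mapping.keys m \<subseteq> dual scale" for m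
    using that
  proof (induction m rule: poly_mapping_induct_on)
    case zero
    show ?case using const by (simp add: sym_const_eq pconst_def)
  next
    case (add m n)
    show ?case
    proof
      fix a :: 'k
      have "Poly_Mapping.single (m + n) a = Poly_Mapping.single m a * Poly_Mapping.single n 1"
        by (simp add: mult_single)
      then show "Q (?\<pi> (Poly_Mapping.single (m + n) a))"
        using mult add single_carrier by (simp add: sym_class_simps sym_class_closed)
    qed
  next
    case (single \<phi> k)
    show ?case
    proof (induction k)
      case 0
      show ?case using const by (simp add: sym_const_eq pconst_def)
    next
      case (Suc k)
      show ?case
      proof
        fix a :: 'k
        have "Poly_Mapping.single (Poly_Mapping.single \<phi> (Suc k)) a
            = Poly_Mapping.single (Poly_Mapping.single \<phi> k) a * pvar \<phi>"
          by (simp add: pvar_def mult_single flip: single_add)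
        moreover have "Poly_Mapping.single (Poly_Mapping.single \<phi> k) a \<in> carrier ?A"
          using single by (intro single_carrier) auto
        ultimately show "Q (?\<pi> (Poly_Mapping.single (Poly_Mapping.single \<phi> (Suc k)) a))"
          using mult Suc single dual pvar_carrier[of \<phi> scale]
          by (simp add: sym_class_simps sym_class_closed sym_of_dual_eq)
      qed
    qed
  qed
  obtain p where p: "p \<in> carrier ?A" "f = ?\<pi> p" using f unfolding Sym_carrier by blast
  have "Q (?\<pi> p)" using p(1) unfolding free_alg_carrier
  proof (induction p rule: poly_mapping_induct_on)
    case zero
    show ?case using const[of 0] by (simp add: sym_const_eq pconst_def)
  next
    case (single m a)
    then show ?case using mon by blast
  next
    case (add p q)
    then show ?case using assms(4) by (simp add: sym_class_simps sym_class_closed free_alg_carrier)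
  qed
  then show ?thesis using p(2) by simp
qed

text \<open>Evaluation at \<open>h\<close> maps the free algebra to \<open>T\<close>. It kills the relations because \<open>h\<close> is linear
  over \<open>c\<close>, so it factors through the quotient; uniqueness holds since the generators determine a
  homomorphism.\<close>

lemma sym_hom_universal:
  fixes T :: "('t, 'x) ring_scheme" and scale :: "'k::field \<Rightarrow> 'v::ab_group_add \<Rightarrow> 'v"
  assumes T: "cring T" and h: "\<And>\<phi>. \<phi> \<in> dual scale \<Longrightarrow> h \<phi> \<in> carrier T"
    and c: "\<And>a. c a \<in> carrier T" "\<And>a b. c (a + b) = c a \<oplus>\<^bsub>T\<^esub> c b"
      "\<And>a b. c (a * b) = c a \<otimes>\<^bsub>T\<^esub> c b" "c 1 = \<one>\<^bsub>T\<^esub>"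
    and h_add: "\<And>\<phi> \<psi>. \<phi> \<in> dual scale \<Longrightarrow> \<psi> \<in> dual scale \<Longrightarrow> h (\<lambda>v. \<phi> v + \<psi> v) = h \<phi> \<oplus>\<^bsub>T\<^esub> h \<psi>"
    and h_scale: "\<And>a \<phi>. \<phi> \<in> dual scale \<Longrightarrow> h (\<lambda>v. a * \<phi> v) = c a \<otimes>\<^bsub>T\<^esub> h \<phi>"
  shows "sym_hom scale T c h \<in> ring_hom (Sym scale) T"
    and "sym_hom scale T c h (sym_const scale a) = c a"
    and "\<phi> \<in> dual scale \<Longrightarrow> sym_hom scale T c h (sym_of_dual scale \<phi>) = h \<phi>"
proof -
  let ?A = "free_alg scale" and ?e = "eval_poly T c h"
  interpret T: cring T by (rule T)
  interpret A: cring ?A by (rule free_alg_cring)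
  interpret R: cring "Sym scale" by (rule Sym_cring)
  note ev = eval_poly_closed[OF T h c] eval_poly_add[OF T h c] eval_poly_mult[OF T h c] eval_poly_one[OF T h c]
  have e_hom: "?e \<in> ring_hom ?A T"
    by (rule ring_hom_memI) (use ev in \<open>auto simp: free_alg_carrier\<close>)
  have e_add: "?e (p + q) = ?e p \<oplus>\<^bsub>T\<^esub> ?e q" if "p \<in> carrier ?A" "q \<in> carrier ?A" for p q
    using ring_hom_memE(3)[OF e_hom that] by simp
  have e_mult: "?e (p * q) = ?e p \<otimes>\<^bsub>T\<^esub> ?e q" if "p \<in> carrier ?A" "q \<in> carrier ?A" for p q
    using ring_hom_memE(2)[OF e_hom that] by simp
  have e_closed: "?e p \<in> carrier T" if "p \<in> carrier ?A" for p
    using ring_hom_memE(1)[OF e_hom that] .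
  have e_diff: "?e (p - q) = \<zero>\<^bsub>T\<^esub>" if "p \<in> carrier ?A" "q \<in> carrier ?A" "?e p = ?e q" for p q
  proof -
    have "?e (p - q) \<oplus>\<^bsub>T\<^esub> ?e q = ?e q"
      using e_add[OF free_alg_diff[OF that(1,2)] that(2)] that(3) by simp
    then show ?thesis
      using T.add.r_cancel_one[OF e_closed[OF that(2)] e_closed[OF free_alg_diff[OF that(1,2)]]] by simp
  qed
  have e_const: "?e (pconst a) = c a" for a
    unfolding pconst_def by (rule eval_poly_const[OF T h c])
  have e_var: "?e (pvar \<phi>) = h \<phi>" if "\<phi> \<in> dual scale" for \<phi>
    unfolding pvar_def by (rule eval_poly_var[OF T h c that])
  interpret e: ring_hom_ring ?A T ?e
    by (rule ring_hom_ringI2[OF A.ring_axioms T.ring_axioms e_hom])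
  have "sym_relations scale \<subseteq> a_kernel ?A T ?e"
  proof
    fix r assume "r \<in> sym_relations scale"
    then consider \<phi> \<psi> where "\<phi> \<in> dual scale" "\<psi> \<in> dual scale" "r = pvar (\<lambda>v. \<phi> v + \<psi> v) - (pvar \<phi> + pvar \<psi>)"
      | a \<phi> where "\<phi> \<in> dual scale" "r = pvar (\<lambda>v. a * \<phi> v) - pconst a * pvar \<phi>"
      by (auto simp: sym_relations_def diff_diff_add)
    then have "?e r = \<zero>\<^bsub>T\<^esub>"
    proof cases
      case 1
      show ?thesis unfolding 1(3)
        by (rule e_diff) (use 1 in \<open>simp_all add: pvar_carrier dual_add free_alg_closed e_add e_var h_add\<close>)
    next
      case 2
      show ?thesis unfolding 2(2)
        by (rule e_diff) (use 2 in \<open>simp_all add: pvar_carrier pconst_carrier dual_scale free_alg_closed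
            e_mult e_var e_const h_scale\<close>)
    qed
    then show "r \<in> a_kernel ?A T ?e"
      using subsetD[OF sym_relations_carrier \<open>r \<in> sym_relations scale\<close>]
      unfolding a_kernel_def' by blast
  qed
  then have ker: "sym_ideal scale \<subseteq> a_kernel ?A T ?e"
    unfolding sym_ideal_eq by (rule A.genideal_minimal[OF e.kernel_is_ideal])
  define f where "f = (\<lambda>U\<in>carrier (Sym scale). ?e (SOME p. p \<in> U))"
  have f: "f (sym_class scale p) = ?e p" if p: "p \<in> carrier ?A" for p
  proof -
    interpret I: ideal "sym_ideal scale" ?A by (rule sym_ideal_ideal)
    have "p \<in> sym_class scale p" unfolding sym_class_def by (rule I.a_rcos_self[OF p])
    then have "(SOME p'. p' \<in> sym_class scale p) \<in> sym_class scale p" by (rule someI)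
    then have "\<exists>i\<in>sym_ideal scale. (SOME p'. p' \<in> sym_class scale p) = i + p"
      by (simp add: sym_class_def a_r_coset_def')
    then obtain i where i: "i \<in> sym_ideal scale" "(SOME p'. p' \<in> sym_class scale p) = i + p"
      by blast
    have "i \<in> a_kernel ?A T ?e" using ker i(1) by (rule subsetD)
    then have "?e i = \<zero>\<^bsub>T\<^esub>" "i \<in> carrier ?A" unfolding a_kernel_def' by blast+
    then show ?thesis
      using p e_closed[OF p] e_add[of i p] i(2) sym_class_closed[OF p] by (simp add: f_def)
  qed
  have f_hom: "f \<in> ring_hom (Sym scale) T"
  proof (rule ring_hom_memI)
    show "f \<one>\<^bsub>Sym scale\<^esub> = \<one>\<^bsub>T\<^esub>"
      using f[of 1] ring_hom_memE(4)[OF e_hom] A.one_closed by (simp add: sym_class_one)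
    fix U assume "U \<in> carrier (Sym scale)"
    then obtain p where p: "p \<in> carrier ?A" "U = sym_class scale p" unfolding Sym_carrier by blast
    show "f U \<in> carrier T" using p f e_closed by simp
    fix W assume "W \<in> carrier (Sym scale)"
    then obtain q where q: "q \<in> carrier ?A" "W = sym_class scale q" unfolding Sym_carrier by blast
    show "f (U \<otimes>\<^bsub>Sym scale\<^esub> W) = f U \<otimes>\<^bsub>T\<^esub> f W"
      unfolding p(2) q(2) sym_class_simps(2)[OF p(1) q(1), symmetric]
      using p q by (simp add: f free_alg_closed e_mult)
    show "f (U \<oplus>\<^bsub>Sym scale\<^esub> W) = f U \<oplus>\<^bsub>T\<^esub> f W"
      unfolding p(2) q(2) sym_class_simps(1)[OF p(1) q(1), symmetric]
      using p q by (simp add: f free_alg_closed e_add)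
  qed
  let ?spec = "\<lambda>f. f \<in> extensional (carrier (Sym scale)) \<and> f \<in> ring_hom (Sym scale) T \<and>
       (\<forall>a. f (sym_const scale a) = c a) \<and> (\<forall>\<phi> \<in> dual scale. f (sym_of_dual scale \<phi>) = h \<phi>)"
  have f_ext: "f \<in> extensional (carrier (Sym scale))" by (simp add: f_def)
  have f_gens: "f (sym_const scale a) = c a" "\<phi> \<in> dual scale \<Longrightarrow> f (sym_of_dual scale \<phi>) = h \<phi>" for a \<phi>
    unfolding sym_const_eq sym_of_dual_eq
    using f[OF pconst_carrier] f[OF pvar_carrier] by (simp_all add: e_const e_var)
  have "?spec f" using f_ext f_hom f_gens by blast
  moreover have "f' = f" if "?spec f'" for f'
  proof (rule extensionalityI)
    show "f' \<in> extensional (carrier (Sym scale))" "f \<in> extensional (carrier (Sym scale))"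
      using that f_ext by blast+
    have f'_hom: "f' \<in> ring_hom (Sym scale) T" using that by blast
    fix x assume "x \<in> carrier (Sym scale)"
    then show "f' x = f x"
    proof (induction x rule: Sym_induct)
      case (add x y)
      then show ?case using ring_hom_memE(3)[OF f'_hom add(1,2)] ring_hom_memE(3)[OF f_hom add(1,2)] by simp
    next
      case (mult x y)
      then show ?case using ring_hom_memE(2)[OF f'_hom mult(1,2)] ring_hom_memE(2)[OF f_hom mult(1,2)] by simp
    qed (use that f_gens in simp_all)
  qed
  ultimately have "?spec (sym_hom scale T c h)"
    unfolding sym_hom_def by (rule theI)
  then show "sym_hom scale T c h \<in> ring_hom (Sym scale) T"
    "sym_hom scale T c h (sym_const scale a) = c a"
    "\<phi> \<in> dual scale \<Longrightarrow> sym_hom scale T c h (sym_of_dual scale \<phi>) = h \<phi>" by auto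
qed

section \<open>Finite fields\<close>

text \<open>Multiplication by \<open>a \<noteq> 0\<close> permutes the nonzero elements; compare their products.\<close>

lemma finite_field_power_card:
  fixes a :: "'k::{field, finite}"
  shows "a ^ card (UNIV :: 'k set) = a"
proof (cases "a = 0")
  case False
  let ?U = "UNIV - {0 :: 'k}"
  have "(\<Prod>x\<in>?U. a * x) = (\<Prod>x\<in>?U. x)"
    by (rule prod.reindex_bij_witness[of _ "\<lambda>x. x / a" "\<lambda>x. a * x"]) (use False in auto)
  then have "a ^ card ?U * (\<Prod>x\<in>?U. x) = 1 * (\<Prod>x\<in>?U. x)"
    by (simp add: prod.distrib)
  then have "a ^ card ?U = 1" by (subst (asm) mult_right_cancel) auto
  moreover have "card (UNIV :: 'k set) = Suc (card ?U)"
    by (rule card_Suc_Diff1[symmetric]) simp_all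
  ultimately show ?thesis by (simp only: power_Suc mult_1_right)
qed (simp add: card_gt_0_iff)

text \<open>Translation by \<open>1\<close> permutes the field; compare the sums of all elements.\<close>

lemma finite_field_of_nat_card: "of_nat (card (UNIV :: 'k set)) = (0 :: 'k::{field, finite})"
proof -
  have "(\<Sum>x\<in>UNIV. x + (1 :: 'k)) = (\<Sum>x\<in>UNIV. x)"
    by (rule sum.reindex_bij_witness[of _ "\<lambda>x. x - 1" "\<lambda>x. x + 1"]) auto
  then show ?thesis by (simp add: sum.distrib)
qed

lemma CHAR_finite_field:
  assumes "Factorial_Ring.prime p" "card (UNIV :: 'k::{field, finite} set) = p ^ r"
  shows "CHAR('k) = p"
proof -
  have "CHAR('k) dvd p ^ r"
    using finite_field_of_nat_card[where 'k = 'k] assms(2) of_nat_eq_0_iff_char_dvd by metis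
  moreover have "Factorial_Ring.prime CHAR('k)"
    by (rule prime_CHAR_semidom) (simp add: finite_imp_CHAR_pos)
  ultimately show ?thesis
    using assms(1) by (metis prime_dvd_power primes_dvd_imp_eq)
qed

lemma CHAR_poly_mapping: "CHAR('m::monoid_add \<Rightarrow>\<^sub>0 'k::comm_semiring_1) = CHAR('k)"
proof (rule CHAR_eqI)
  have lookup: "poly_mapping.lookup (of_nat n :: 'm \<Rightarrow>\<^sub>0 'k) 0 = of_nat n" for n
    by (simp add: lookup_of_nat)
  have "of_nat n = (0 :: 'm \<Rightarrow>\<^sub>0 'k) \<longleftrightarrow> of_nat n = (0 :: 'k)" for n
  proof
    assume "of_nat n = (0 :: 'k)"
    then have "Poly_Mapping.single (0 :: 'm) (of_nat n :: 'k) = 0" by (simp del: single_of_nat)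
    then show "of_nat n = (0 :: 'm \<Rightarrow>\<^sub>0 'k)" by simp
  qed (use lookup[of n] in simp)
  then show "of_nat CHAR('k) = (0 :: 'm \<Rightarrow>\<^sub>0 'k)" "\<And>n. of_nat n = (0 :: 'm \<Rightarrow>\<^sub>0 'k) \<Longrightarrow> CHAR('k) dvd n"
    by (simp_all add: of_nat_eq_0_iff_char_dvd)
qed

section \<open>Steenrod operators on the symmetric algebra\<close>

lemma sym_class_pow:
  assumes "p \<in> carrier (free_alg scale)"
  shows "sym_class scale p [^]\<^bsub>Sym scale\<^esub> (n :: nat) = sym_class scale (p ^ n)"
proof -
  have "p ^ n \<in> carrier (free_alg scale) \<and> sym_class scale p [^]\<^bsub>Sym scale\<^esub> n = sym_class scale (p ^ n)"
  proof (induction n)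
    case 0
    show ?case using pconst_carrier[of 1 scale] by (simp add: sym_class_one pconst_def)
  next
    case (Suc n)
    then show ?case
      using assms free_alg_closed(2)[of "p ^ n" scale p] sym_class_simps(2)[of "p ^ n" scale p]
      by (simp add: mult.commute)
  qed
  then show ?thesis by simp
qed

text \<open>The identity already holds in the free algebra, which has the same characteristic as the field.\<close>

lemma Sym_frobenius_add:
  fixes scale :: "'k::{field, finite} \<Rightarrow> 'v::ab_group_add \<Rightarrow> 'v"
  assumes p: "Factorial_Ring.prime p" "card (UNIV :: 'k set) = p ^ r"
    and "f \<in> carrier (Sym scale)" "g \<in> carrier (Sym scale)"
  shows "(f \<oplus>\<^bsub>Sym scale\<^esub> g) [^]\<^bsub>Sym scale\<^esub> (p ^ r)
       = f [^]\<^bsub>Sym scale\<^esub> (p ^ r) \<oplus>\<^bsub>Sym scale\<^esub> g [^]\<^bsub>Sym scale\<^esub> (p ^ r)"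
proof -
  obtain x y where x: "x \<in> carrier (free_alg scale)" "f = sym_class scale x"
    and y: "y \<in> carrier (free_alg scale)" "g = sym_class scale y"
    using assms(3,4) unfolding Sym_carrier by blast
  have "CHAR(('k, 'v) dual_poly) = p"
    using CHAR_finite_field[OF p] by (simp add: CHAR_poly_mapping)
  then have eq: "(x + y) ^ (p ^ r) = x ^ (p ^ r) + y ^ (p ^ r)"
    using freshmans_dream'[where 'a = "('k, 'v) dual_poly" and m = "p ^ r" and n = r] p(1) by simp
  have pow: "z ^ n \<in> carrier (free_alg scale)" if "z \<in> carrier (free_alg scale)" for z n
  proof -
    interpret cring "free_alg scale" by (rule free_alg_cring)
    show ?thesis using nat_pow_closed[OF that] by (simp add: free_alg_pow)
  qed
  have "(f \<oplus>\<^bsub>Sym scale\<^esub> g) [^]\<^bsub>Sym scale\<^esub> (p ^ r) = sym_class scale ((x + y) ^ (p ^ r))"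
    unfolding x(2) y(2) sym_class_simps(1)[OF x(1) y(1), symmetric]
    by (rule sym_class_pow[OF free_alg_closed(1)[OF x(1) y(1)]])
  then show ?thesis
    unfolding eq x(2) y(2) sym_class_pow[OF x(1)] sym_class_pow[OF y(1)]
    by (simp add: sym_class_simps(1)[OF pow[OF x(1)] pow[OF y(1)]])
qed

lemma sym_const_pow:
  fixes scale :: "'k::field \<Rightarrow> 'v::ab_group_add \<Rightarrow> 'v"
  shows "sym_const scale a [^]\<^bsub>Sym scale\<^esub> (n :: nat) = sym_const scale (a ^ n)"
proof -
  have "pconst a ^ n = (pconst (a ^ n) :: ('k, 'v) dual_poly)"
    by (induction n) (simp_all add: pconst_def mult_single)
  then show ?thesis by (simp add: sym_const_eq sym_class_pow pconst_carrier)
qed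

context
  fixes scale :: "'k::{field, finite} \<Rightarrow> 'v::ab_group_add \<Rightarrow> 'v" and p q r :: nat
  assumes p: "Factorial_Ring.prime p" and q_def: "q = p ^ r" and card_k: "card (UNIV :: 'k set) = q"
begin

interpretation R: cring "Sym scale" by (rule Sym_cring)
interpretation U: UP_cring "Sym scale" "UP (Sym scale)"
  by (intro UP_cring.intro R.cring_axioms) simp

text \<open>The assignment \<open>\<phi> \<mapsto> \<phi> + \<phi>\<^sup>q \<xi>\<close> is additive because \<open>q\<close> is a power of the characteristic, and
  linear because \<open>a\<^sup>q = a\<close> for scalars.\<close>

lemma steenrod_total_hom:
  shows "steenrod_total scale q \<in> ring_hom (Sym scale) (UP (Sym scale))"
    and "steenrod_total scale q (sym_const scale a) = up_ring.monom (UP (Sym scale)) (sym_const scale a) 0"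
    and "\<phi> \<in> dual scale \<Longrightarrow> steenrod_total scale q (sym_of_dual scale \<phi>) =
       up_ring.monom (UP (Sym scale)) (sym_of_dual scale \<phi>) 0 \<oplus>\<^bsub>UP (Sym scale)\<^esub>
       up_ring.monom (UP (Sym scale)) (sym_of_dual scale \<phi> [^]\<^bsub>Sym scale\<^esub> q) 1"
proof -
  let ?RX = "UP (Sym scale)"
  let ?c = "\<lambda>a. up_ring.monom ?RX (sym_const scale a) 0"
  let ?h = "\<lambda>\<phi>. up_ring.monom ?RX (sym_of_dual scale \<phi>) 0 \<oplus>\<^bsub>?RX\<^esub>
              up_ring.monom ?RX (sym_of_dual scale \<phi> [^]\<^bsub>Sym scale\<^esub> q) 1"
  have card: "card (UNIV :: 'k set) = p ^ r" using card_k q_def by simp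
  have eq: "steenrod_total scale q = sym_hom scale ?RX ?c ?h"
    by (simp add: steenrod_total_def Let_def)
  have c: "?c a \<in> carrier ?RX" "?c (a + b) = ?c a \<oplus>\<^bsub>?RX\<^esub> ?c b"
      "?c (a * b) = ?c a \<otimes>\<^bsub>?RX\<^esub> ?c b" "?c 1 = \<one>\<^bsub>?RX\<^esub>" for a b
    using U.monom_mult[of "sym_const scale a" "sym_const scale b" 0 0]
    by (simp_all add: sym_const_add sym_const_mult sym_const_one)
  have h: "?h \<phi> \<in> carrier ?RX" if "\<phi> \<in> dual scale" for \<phi> using that by simp
  have h_add: "?h (\<lambda>v. \<phi> v + \<psi> v) = ?h \<phi> \<oplus>\<^bsub>?RX\<^esub> ?h \<psi>" if "\<phi> \<in> dual scale" "\<psi> \<in> dual scale" for \<phi> \<psi>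
    using that Sym_frobenius_add[OF p card, of "sym_of_dual scale \<phi>" scale "sym_of_dual scale \<psi>"]
    by (simp add: sym_of_dual_add q_def U.P.a_ac)
  have h_scale: "?h (\<lambda>v. a * \<phi> v) = ?c a \<otimes>\<^bsub>?RX\<^esub> ?h \<phi>" if "\<phi> \<in> dual scale" for a \<phi>
  proof -
    have "(sym_const scale a \<otimes>\<^bsub>Sym scale\<^esub> sym_of_dual scale \<phi>) [^]\<^bsub>Sym scale\<^esub> q
        = sym_const scale a \<otimes>\<^bsub>Sym scale\<^esub> (sym_of_dual scale \<phi> [^]\<^bsub>Sym scale\<^esub> q)"
      using that finite_field_power_card[of a] card_k
      by (simp add: R.nat_pow_distrib sym_const_pow)
    then show ?thesis
      using that U.monom_mult[of "sym_const scale a" "sym_of_dual scale \<phi>" 0 0]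
        U.monom_mult[of "sym_const scale a" "sym_of_dual scale \<phi> [^]\<^bsub>Sym scale\<^esub> q" 0 1]
      by (simp add: sym_of_dual_scale U.P.r_distr)
  qed
  note args = U.P.cring_axioms h c h_add h_scale
  show "steenrod_total scale q \<in> ring_hom (Sym scale) ?RX"
    unfolding eq by (rule sym_hom_universal(1)[OF args])
  show "steenrod_total scale q (sym_const scale a) = ?c a"
    unfolding eq by (rule sym_hom_universal(2)[OF args])
  show "steenrod_total scale q (sym_of_dual scale \<phi>) = ?h \<phi>" if "\<phi> \<in> dual scale"
    unfolding eq by (rule sym_hom_universal(3)[OF args that])
qed

lemma steenrod_closed: "f \<in> carrier (Sym scale) \<Longrightarrow> steenrod scale q m f \<in> carrier (Sym scale)"
  using ring_hom_memE(1)[OF steenrod_total_hom(1)] by (simp add: steenrod_def)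

lemma steenrod_add:
  "f \<in> carrier (Sym scale) \<Longrightarrow> g \<in> carrier (Sym scale) \<Longrightarrow>
    steenrod scale q m (f \<oplus>\<^bsub>Sym scale\<^esub> g) = steenrod scale q m f \<oplus>\<^bsub>Sym scale\<^esub> steenrod scale q m g"
  using ring_hom_memE(1,3)[OF steenrod_total_hom(1)] by (simp add: steenrod_def)

lemma steenrod_mult:
  "f \<in> carrier (Sym scale) \<Longrightarrow> g \<in> carrier (Sym scale) \<Longrightarrow>
    steenrod scale q m (f \<otimes>\<^bsub>Sym scale\<^esub> g) =
    (\<Oplus>\<^bsub>Sym scale\<^esub>a\<in>{..m}. steenrod scale q a f \<otimes>\<^bsub>Sym scale\<^esub> steenrod scale q (m - a) g)"
  using ring_hom_memE(1,2)[OF steenrod_total_hom(1)] by (simp add: steenrod_def)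

lemma steenrod_const:
  "steenrod scale q m (sym_const scale a) = (if m = 0 then sym_const scale a else \<zero>\<^bsub>Sym scale\<^esub>)"
  by (simp add: steenrod_def steenrod_total_hom(2))

lemma steenrod_of_dual:
  assumes "\<phi> \<in> dual scale"
  shows "steenrod scale q m (sym_of_dual scale \<phi>) = (if m = 0 then sym_of_dual scale \<phi>
    else if m = 1 then sym_of_dual scale \<phi> [^]\<^bsub>Sym scale\<^esub> q else \<zero>\<^bsub>Sym scale\<^esub>)"
  using assms by (simp add: steenrod_def steenrod_total_hom(3))

lemma steenrod_0: "f \<in> carrier (Sym scale) \<Longrightarrow> steenrod scale q 0 f = f"
  by (induction f rule: Sym_induct)
     (simp_all add: steenrod_const steenrod_of_dual steenrod_add steenrod_mult)

text \<open>Steenrod operators commute with every substitution of linear forms for linear forms: the two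
  sides agree on generators, and the Cartan formula passes the agreement on to products.\<close>

lemma steenrod_ring_hom:
  assumes \<alpha>: "\<alpha> \<in> ring_hom (Sym scale) (Sym scale)"
    and const: "\<And>a. \<alpha> (sym_const scale a) = sym_const scale a"
    and dual: "\<And>\<phi>. \<phi> \<in> dual scale \<Longrightarrow> \<exists>\<psi>\<in>dual scale. \<alpha> (sym_of_dual scale \<phi>) = sym_of_dual scale \<psi>"
    and "f \<in> carrier (Sym scale)"
  shows "steenrod scale q m (\<alpha> f) = \<alpha> (steenrod scale q m f)"
proof -
  interpret \<alpha>: ring_hom_cring "Sym scale" "Sym scale" \<alpha>
    by (intro ring_hom_cring.intro ring_hom_cring_axioms.intro R.cring_axioms \<alpha>)
  have "\<forall>m. steenrod scale q m (\<alpha> f) = \<alpha> (steenrod scale q m f)"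
    using assms(4)
  proof (induction f rule: Sym_induct)
    case (const a)
    show ?case by (simp add: assms(2) steenrod_const)
  next
    case (dual \<phi>)
    then obtain \<psi> where "\<psi> \<in> dual scale" "\<alpha> (sym_of_dual scale \<phi>) = sym_of_dual scale \<psi>"
      using assms(3) by blast
    then show ?case using dual by (simp add: steenrod_of_dual)
  next
    case (add f g)
    then show ?case by (simp add: steenrod_add steenrod_closed)
  next
    case (mult f g)
    show ?case
    proof
      fix m
      have "\<alpha> (steenrod scale q m (f \<otimes>\<^bsub>Sym scale\<^esub> g))
          = (\<Oplus>\<^bsub>Sym scale\<^esub>a\<in>{..m}. \<alpha> (steenrod scale q a f \<otimes>\<^bsub>Sym scale\<^esub> steenrod scale q (m - a) g))"
        unfolding steenrod_mult[OF mult(1,2)]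
        by (subst \<alpha>.hom_finsum) (use mult in \<open>auto simp: steenrod_closed comp_def\<close>)
      also have "\<dots> = steenrod scale q m (\<alpha> (f \<otimes>\<^bsub>Sym scale\<^esub> g))"
        using mult by (simp add: steenrod_mult steenrod_closed cong: R.finsum_cong)
      finally show "steenrod scale q m (\<alpha> (f \<otimes>\<^bsub>Sym scale\<^esub> g)) = \<alpha> (steenrod scale q m (f \<otimes>\<^bsub>Sym scale\<^esub> g))" ..
    qed
  qed
  then show ?thesis by blast
qed

end

section \<open>The group action\<close>

lemma sym_action_hom:
  assumes "\<And>\<phi>. \<phi> \<in> dual scale \<Longrightarrow> \<phi> \<circ> inv\<^bsub>GL scale\<^esub> g \<in> dual scale"
  shows "sym_action scale g \<in> ring_hom (Sym scale) (Sym scale)"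
    and "sym_action scale g (sym_const scale a) = sym_const scale a"
    and "\<phi> \<in> dual scale \<Longrightarrow> sym_action scale g (sym_of_dual scale \<phi>) = sym_of_dual scale (\<phi> \<circ> inv\<^bsub>GL scale\<^esub> g)"
proof -
  let ?h = "\<lambda>\<phi>. sym_of_dual scale (\<phi> \<circ> inv\<^bsub>GL scale\<^esub> g)"
  have h_add: "?h (\<lambda>v. \<phi> v + \<psi> v) = ?h \<phi> \<oplus>\<^bsub>Sym scale\<^esub> ?h \<psi>"
    if "\<phi> \<in> dual scale" "\<psi> \<in> dual scale" for \<phi> \<psi>
    using sym_of_dual_add[OF assms[OF that(1)] assms[OF that(2)]] by (simp add: comp_def)
  have h_scale: "?h (\<lambda>v. a * \<phi> v) = sym_const scale a \<otimes>\<^bsub>Sym scale\<^esub> ?h \<phi>" if "\<phi> \<in> dual scale" for a \<phi>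
    using sym_of_dual_scale[OF assms[OF that]] by (simp add: comp_def)
  note args = Sym_cring sym_of_dual_carrier[OF assms] sym_const_carrier sym_const_add sym_const_mult
    sym_const_one h_add h_scale
  show "sym_action scale g \<in> ring_hom (Sym scale) (Sym scale)"
    unfolding sym_action_def by (rule sym_hom_universal(1)[OF args])
  show "sym_action scale g (sym_const scale a) = sym_const scale a"
    unfolding sym_action_def by (rule sym_hom_universal(2)[OF args])
  show "sym_action scale g (sym_of_dual scale \<phi>) = ?h \<phi>" if "\<phi> \<in> dual scale"
    unfolding sym_action_def by (rule sym_hom_universal(3)[OF args that])
qed

lemma dual_comp_inv_GL:
  assumes "subgroup G (GL scale)" "g \<in> G" "\<phi> \<in> dual scale"
  shows "\<phi> \<circ> inv\<^bsub>GL scale\<^esub> g \<in> dual scale"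
proof -
  have "inv\<^bsub>GL scale\<^esub> g \<in> carrier (GL scale)"
    using subgroup.m_inv_closed[OF assms(1,2)] subgroup.subset[OF assms(1)] by blast
  then have "Vector_Spaces.linear scale scale (inv\<^bsub>GL scale\<^esub> g)" by (simp add: GL_def)
  then show ?thesis using assms(3) by (auto simp: dual_def Vector_Spaces.linear_iff)
qed

lemma infinite_sym: "infinite (UNIV :: ('k::field, 'v) sym set)"
proof -
  have "inj (\<lambda>n. {Poly_Mapping.single (Poly_Mapping.single (undefined :: 'v \<Rightarrow> 'k) (n :: nat)) (1 :: 'k)})"
    by (rule injI) (simp, metis lookup_single_eq lookup_single_not_eq one_neq_zero)
  then show ?thesis using finite_imageD infinite_UNIV_nat rev_finite_subset subset_UNIV by metis
qed

section \<open>Steenrod operations on group cohomology\<close>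

text \<open>The module structure on \<open>R\<close> has the same addition, but sits in a different record type.\<close>

lemma finsum_regular_module: "finsum (regular_module R) f A = finsum R f A"
  by (simp add: finsum_def finprod_def regular_module_def)

lemma regular_module_abelian_group:
  assumes "ring R"
  shows "abelian_group (regular_module R)"
proof -
  interpret ring R by fact
  show ?thesis
  proof (rule abelian_groupI)
    fix x assume "x \<in> carrier (regular_module R)"
    then show "\<exists>y\<in>carrier (regular_module R). y \<oplus>\<^bsub>regular_module R\<^esub> x = \<zero>\<^bsub>regular_module R\<^esub>"
      by (intro bexI[of _ "\<ominus>\<^bsub>R\<^esub> x"]) (auto simp: regular_module_def l_neg)
  qed (auto simp: regular_module_def a_ac)
qed

theorem theorem3p1:
  fixes scale :: "'k::{field, finite} \<Rightarrow> 'v::ab_group_add \<Rightarrow> 'v"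
    and Basis :: "'v set"
    and G :: "('v \<Rightarrow> 'v) set"
    and p q r d i :: nat
    and E :: "nat \<Rightarrow> (('k, 'v) sym, 'm) module"
    and \<sigma> :: "nat \<Rightarrow> ('v \<Rightarrow> 'v) \<Rightarrow> 'm \<Rightarrow> 'm"
    and \<epsilon> :: "('k, 'v) sym \<Rightarrow> 'm"
    and \<delta> :: "nat \<Rightarrow> 'm \<Rightarrow> 'm"
  defines "S \<equiv> invariant_ring scale G"
    and "\<G> \<equiv> (GL scale)\<lparr>carrier := G\<rparr>"
  defines "H \<equiv> group_cohomology \<G> E \<sigma> \<delta> i"
  assumes "Factorial_Ring.prime p" and "r > 0" and "q = p ^ r" and "card (UNIV :: 'k set) = q"
    and "finite_dimensional_vector_space scale Basis" and "vector_space.dim scale UNIV = d"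
    and "subgroup G (GL scale)"
    and "injective_resolution S \<G> (regular_module (Sym scale)) (sym_action scale) E \<sigma> \<epsilon> \<delta>"
  shows "\<exists>Q :: nat \<Rightarrow> 'm set \<Rightarrow> 'm set.
    (\<forall>m. Q m \<in> mod_hom (ground_field scale) H H) \<and>
    (\<forall>\<alpha> \<in> carrier H. Q 0 \<alpha> = \<alpha>) \<and>
    (\<forall>m. \<forall>s \<in> carrier S. \<forall>\<alpha> \<in> carrier H.
       Q m (s \<odot>\<^bsub>H\<^esub> \<alpha>) =
         (\<Oplus>\<^bsub>H\<^esub>a \<in> {..m}. steenrod scale q a s \<odot>\<^bsub>H\<^esub> Q (m - a) \<alpha>))"
proof -
  let ?R = "Sym scale" and ?P = "steenrod scale q" and ?act = "sym_action scale"
  let ?M = "regular_module ?R"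
  note p = assms(4) and q = assms(6) and card_k = assms(7)
  note G = assms(10) and res = assms(11)
  interpret R: cring ?R by (rule Sym_cring)
  have carrier_G: "carrier \<G> = G" by (simp add: \<G>_def)
  have carrier_S: "carrier S = {f \<in> carrier ?R. \<forall>g\<in>G. ?act g f = f}"
    by (simp add: S_def invariant_ring_def)
  have S_eq: "S = ?R\<lparr>carrier := carrier S\<rparr>"
    by (simp add: S_def invariant_ring_def)
  have S_simps [simp]: "x \<oplus>\<^bsub>S\<^esub> y = x \<oplus>\<^bsub>?R\<^esub> y" "x \<otimes>\<^bsub>S\<^esub> y = x \<otimes>\<^bsub>?R\<^esub> y"
      "\<one>\<^bsub>S\<^esub> = \<one>\<^bsub>?R\<^esub>" "\<zero>\<^bsub>S\<^esub> = \<zero>\<^bsub>?R\<^esub>" for x y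
    by (simp_all add: S_def invariant_ring_def)
  have S_sub: "carrier S \<subseteq> carrier ?R" by (auto simp: carrier_S)
  then have S_mem: "s \<in> carrier S \<Longrightarrow> s \<in> carrier ?R" for s by blast
  \<comment> \<open>The invariants form a ring because \<open>E 0\<close> is a module over them.\<close>
  have "injective_module S \<G> (E 0) (\<sigma> 0)" using res by (simp add: injective_resolution_def)
  then have "group_ring_module S \<G> (E 0) (\<sigma> 0)" by (simp add: injective_module_def)
  then have "module S (E 0)" by (rule group_ring_moduleD)
  then have S_cring: "cring S" by (rule module.axioms)

  note act_dual = dual_comp_inv_GL[OF G]
  note act_hom = sym_action_hom(1)[OF act_dual] and act_const = sym_action_hom(2)[OF act_dual]
    and act_gen = sym_action_hom(3)[OF act_dual]
  have act_closed: "?act g f \<in> carrier ?R" if "g \<in> G" "f \<in> carrier ?R" for g f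
    using ring_hom_memE(1)[OF act_hom[OF that(1)] that(2)] .
  have P_act: "?P m (?act g f) = ?act g (?P m f)" if "g \<in> G" "f \<in> carrier ?R" for m g f
    using act_hom[OF that(1)] act_const[OF that(1)] act_gen[OF that(1)] act_dual[OF that(1)] that(2)
    by (intro steenrod_ring_hom[OF p q card_k]) blast+
  note P_closed = steenrod_closed[where scale = scale, OF p q card_k] and P_add = steenrod_add[where scale = scale, OF p q card_k]
    and P_mult = steenrod_mult[where scale = scale, OF p q card_k] and P_0 = steenrod_0[where scale = scale, OF p q card_k]
    and P_const = steenrod_const[where scale = scale, OF p q card_k]
  have P_S: "?P m s \<in> carrier S" if "s \<in> carrier S" for m s
    using that P_closed P_act[of _ s m] by (auto simp: carrier_S)
  interpret C: cartan_ring S ?P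
  proof (intro cartan_ring.intro cartan_ring_axioms.intro S_cring)
    fix s t m assume st: "s \<in> carrier S" "t \<in> carrier S"
    show "?P m (s \<otimes>\<^bsub>S\<^esub> t) = (\<Oplus>\<^bsub>S\<^esub>a\<in>{..m}. ?P a s \<otimes>\<^bsub>S\<^esub> ?P (m - a) t)"
    proof -
      have "(\<Oplus>\<^bsub>S\<^esub>a\<in>{..m}. ?P a s \<otimes>\<^bsub>S\<^esub> ?P (m - a) t) = (\<Oplus>\<^bsub>?R\<^esub>a\<in>{..m}. ?P a s \<otimes>\<^bsub>S\<^esub> ?P (m - a) t)"
        by (subst S_eq, rule finsum_restrict_carrier)
           (use S_sub S_eq R.abelian_monoid_axioms cring.axioms(1)[OF S_cring, THEN ring.is_abelian_group]
             st P_S monoid.m_closed[OF ring.is_monoid[OF cring.axioms(1)[OF S_cring]]]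
            in \<open>auto simp: abelian_group_def simp del: S_simps\<close>)
      then show ?thesis using P_mult[of s t m] st S_mem by simp
    qed
  qed (use S_mem P_S P_add P_0 P_const[of _ 1] in \<open>auto simp: sym_const_one\<close>)

  have M_sel: "carrier ?M = carrier ?R" "x \<oplus>\<^bsub>?M\<^esub> y = x \<oplus>\<^bsub>?R\<^esub> y" "s \<odot>\<^bsub>?M\<^esub> x = s \<otimes>\<^bsub>?R\<^esub> x" for x y s
    by (simp_all add: regular_module_def)
  have P_M: "C.cartan_op \<G> ?M ?act (carrier ?M) ?P m" for m
    using S_mem P_closed P_add P_act P_mult
    by (auto simp: C.cartan_op_def M_sel carrier_G finsum_regular_module)
  have M: "abelian_group ?M" by (rule regular_module_abelian_group[OF R.ring_axioms])
  have smult_M: "s \<odot>\<^bsub>?M\<^esub> x \<in> carrier ?M" if "s \<in> carrier S" "x \<in> carrier ?M" for s x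
    using that S_mem by (simp add: M_sel)
  have act_M: "?act g x \<in> carrier ?M" if "g \<in> carrier \<G>" "x \<in> carrier ?M" for g x
    using that act_closed by (simp add: M_sel carrier_G)
  have P_M0: "?P 0 x = x" if "x \<in> carrier ?M" for x using that P_0 by (simp add: M_sel)
  note coh = C.cartan_cohomology[OF infinite_sym res M smult_M act_M P_M P_M0, of i, folded H_def]
  interpret H: module S H by (rule coh(1))
  obtain Q where Q: "\<forall>m. \<forall>\<alpha>\<in>carrier H. Q m \<alpha> \<in> carrier H"
      "\<forall>m. \<forall>\<alpha>\<in>carrier H. \<forall>\<beta>\<in>carrier H. Q m (\<alpha> \<oplus>\<^bsub>H\<^esub> \<beta>) = Q m \<alpha> \<oplus>\<^bsub>H\<^esub> Q m \<beta>"
      "\<forall>\<alpha>\<in>carrier H. Q 0 \<alpha> = \<alpha>"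
      "\<forall>m. \<forall>s\<in>carrier S. \<forall>\<alpha>\<in>carrier H.
         Q m (s \<odot>\<^bsub>H\<^esub> \<alpha>) = (\<Oplus>\<^bsub>H\<^esub>a\<in>{..m}. ?P a s \<odot>\<^bsub>H\<^esub> Q (m - a) \<alpha>)"
    by (rule exE[OF coh(2)], assumption+, elim conjE, rule that)
  have Q_closed: "Q m \<alpha> \<in> carrier H" if "\<alpha> \<in> carrier H" for m \<alpha> using Q(1) that by simp
  have const_S: "sym_const scale a \<in> carrier S" for a
    using act_const by (simp add: carrier_S)
  \<comment> \<open>Scalars are killed by all \<open>P\<^sup>a\<close> with \<open>a > 0\<close>, so the Cartan formula contains linearity over the field.\<close>
  have Q_const: "Q m (sym_const scale c \<odot>\<^bsub>H\<^esub> \<alpha>) = sym_const scale c \<odot>\<^bsub>H\<^esub> Q m \<alpha>"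
    if "\<alpha> \<in> carrier H" for m c \<alpha>
  proof -
    have zero: "\<zero>\<^bsub>?R\<^esub> \<odot>\<^bsub>H\<^esub> \<beta> = \<zero>\<^bsub>H\<^esub>" if "\<beta> \<in> carrier H" for \<beta>
      using H.smult_l_null[OF that] by simp
    have "Q m (sym_const scale c \<odot>\<^bsub>H\<^esub> \<alpha>) = (\<Oplus>\<^bsub>H\<^esub>a\<in>{..m}. ?P a (sym_const scale c) \<odot>\<^bsub>H\<^esub> Q (m - a) \<alpha>)"
      using Q(4) const_S that by simp
    also have "\<dots> = (\<Oplus>\<^bsub>H\<^esub>a\<in>{0}. sym_const scale c \<odot>\<^bsub>H\<^esub> Q (m - a) \<alpha>)"
      by (rule H.add.finprod_mono_neutral_cong_right)
         (use that const_S P_S Q_closed zero in \<open>auto simp: P_const\<close>)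
    finally show ?thesis using that const_S Q_closed by simp
  qed
  have "Q m \<in> mod_hom (ground_field scale) H H" for m
    using Q_closed Q(2) Q_const by (auto simp: mod_hom_def ground_field_def)
  then have "\<forall>m. Q m \<in> mod_hom (ground_field scale) H H" by blast
  with Q(3,4) show ?thesis by (intro exI[of _ Q] conjI)
qed

end
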